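(* Let $C(\cdot,t)$, $t\in(-\infty,+\infty)$, be a family of closed convex smooth embedded curves in $\mathbb{R}^2$ solving the flow $$\frac{\partial C(p,t)}{\partial t}=\Big(\lambda+\int_0^{\xi(p)}\varphi\,d\xi\Big)C+\frac{\varphi}{2}C_\xi,$$ where $\lambda$ is a real constant, and suppose its centro-affine curvature $\varphi$ is uniformly bounded on $S^1\times(-\infty,+\infty)$. Then $\varphi$ converges smoothly to zero as $t\to-\infty$; that is, $C(\cdot,t)$ converges to an ellipse as $t\to-\infty$.
   Context: For $u,v\in\mathbb{R}^2$, $[u,v]$ denotes the determinant of the $2\times 2$ matrix with columns $u,v$. The curves $C(\cdot,t):S^1\to\mathbb{R}^2$, $p\mapsto C(p,t)$, are smooth closed curves with $[C,C_p]\neq 0$ and $[C_p,C_{pp}]\neq 0$ (for such closed curves one has $[C_p,C_{pp}]/[C,C_p]>0$). The centro-affine metric is $g=\sqrt{[C_p,C_{pp}]/[C,C_p]}$, the centro-affine arc-length is $\xi(p)=\int_{p_0}^p g\,dp$ (so $\partial_\xi=g^{-1}\partial_p$), and the centro-affine curvature is $\varphi=[C_{\xi\xi},C]/[C_\xi,C]$. *)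

theory Defs
  imports "HOL-Analysis.Analysis"
begin

definition det2 :: "real \<times> real \<Rightarrow> real \<times> real \<Rightarrow> real" where
  "det2 u v = fst u * snd v - snd u * fst v"

text \<open>Families of curves: F p t with p the (2*pi-periodic) curve parameter, t time.
  Partial derivatives in p and in t.\<close>
definition dP :: "(real \<Rightarrow> real \<Rightarrow> 'a::real_normed_vector) \<Rightarrow> real \<Rightarrow> real \<Rightarrow> 'a" where
  "dP F = (\<lambda>p t. vector_derivative (\<lambda>q. F q t) (at p))"

definition dT :: "(real \<Rightarrow> real \<Rightarrow> 'a::real_normed_vector) \<Rightarrow> real \<Rightarrow> real \<Rightarrow> 'a" where
  "dT F = (\<lambda>p t. vector_derivative (\<lambda>s. F p s) (at t))"

definition iter_partial :: "bool list \<Rightarrow> (real \<Rightarrow> real \<Rightarrow> 'a::real_normed_vector) \<Rightarrow> real \<Rightarrow> real \<Rightarrow> 'a" where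
  "iter_partial ws F = foldr (\<lambda>b H. if b then dP H else dT H) ws F"

definition smooth2 :: "(real \<Rightarrow> real \<Rightarrow> 'a::real_normed_vector) \<Rightarrow> bool" where
  "smooth2 F \<longleftrightarrow> (\<forall>ws. let G = iter_partial ws F in
      continuous_on UNIV (\<lambda>z. G (fst z) (snd z)) \<and>
      (\<forall>p t. (\<lambda>q. G q t) differentiable (at p) \<and> (\<lambda>s. G p s) differentiable (at t)))"

definition ca_metric :: "(real \<Rightarrow> real \<Rightarrow> real \<times> real) \<Rightarrow> real \<Rightarrow> real \<Rightarrow> real" where
  "ca_metric C p t = sqrt (det2 (dP C p t) (dP (dP C) p t) / det2 (C p t) (dP C p t))"

definition dXi :: "(real \<Rightarrow> real \<Rightarrow> real \<times> real) \<Rightarrow> (real \<Rightarrow> real \<Rightarrow> 'a::real_normed_vector)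
    \<Rightarrow> real \<Rightarrow> real \<Rightarrow> 'a" where
  "dXi C F = (\<lambda>p t. (1 / ca_metric C p t) *\<^sub>R dP F p t)"

definition ca_curv :: "(real \<Rightarrow> real \<Rightarrow> real \<times> real) \<Rightarrow> real \<Rightarrow> real \<Rightarrow> real" where
  "ca_curv C p t = det2 (dXi C (dXi C C) p t) (C p t) / det2 (dXi C C p t) (C p t)"

end

theory Submission
  imports Defs
begin

text \<open>
  In the centro-affine arc-length \<open>\<xi>\<close> the flow gives \<open>g\<^sub>t = \<phi>\<^sup>2 g / 2\<close> and
  \<open>\<phi>\<^sub>t = \<phi>\<^sub>\<xi>\<^sub>\<xi> / 2 + 2 \<phi> - \<phi>\<^sup>3 / 2\<close>, with \<open>[\<partial>\<^sub>t, \<partial>\<^sub>\<xi>] = - (\<phi>\<^sup>2 / 2) \<partial>\<^sub>\<xi>\<close>. Let \<open>E\<^sub>k\<close> be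
  the integral over the curve of the square of \<open>\<psi>\<^sub>k = \<partial>\<^sub>\<xi>\<^sup>k \<phi>\<close>. The length \<open>L\<close> satisfies
  \<open>L' = E\<^sub>0 / 2\<close> and is positive, so \<open>E\<^sub>0\<close> is integrable near \<open>t = -\<infinity>\<close>. Integration by parts gives
  \<open>E\<^sub>k' \<le> - E\<^sub>k\<^sub>+\<^sub>1 + K (E\<^sub>0 + \<dots> + E\<^sub>k)\<close> as long as \<open>E\<^sub>j \<le> 1\<close> for \<open>j < k\<close>, because the reaction
  terms are sums of products \<open>\<psi>\<^sub>a \<psi>\<^sub>b \<psi>\<^sub>c\<close> with \<open>a + b + c = k\<close>. Hence, inductively, integrability of
  \<open>E\<^sub>0, \<dots>, E\<^sub>k\<close> forces \<open>E\<^sub>k \<rightarrow> 0\<close> and integrability of \<open>E\<^sub>k\<^sub>+\<^sub>1\<close>. Every \<open>\<psi>\<^sub>k\<close> vanishes somewhere on the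
  curve, so \<open>sup \<psi>\<^sub>k\<^sup>2 \<le> E\<^sub>k + E\<^sub>k\<^sub>+\<^sub>1 \<rightarrow> 0\<close>.
\<close>

section \<open>Smooth functions of two variables\<close>

lemma smooth2_continuous:
  assumes "smooth2 F"
  shows "continuous_on UNIV (\<lambda>z. F (fst z) (snd z))"
  using assms[unfolded smooth2_def, rule_format, of "[]"] by (simp add: iter_partial_def)

lemma smooth2_has_vector_derivative_P:
  assumes "smooth2 F"
  shows "((\<lambda>q. F q t) has_vector_derivative dP F p t) (at p)"
  using assms[unfolded smooth2_def, rule_format, of "[]"]
  by (simp add: iter_partial_def dP_def vector_derivative_works[symmetric])

lemma smooth2_has_vector_derivative_T:
  assumes "smooth2 F"
  shows "((\<lambda>s. F p s) has_vector_derivative dT F p t) (at t)"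
  using assms[unfolded smooth2_def, rule_format, of "[]"]
  by (simp add: iter_partial_def dT_def vector_derivative_works[symmetric])

lemma smooth2_dP:
  assumes "smooth2 F"
  shows "smooth2 (dP F)"
proof -
  have "iter_partial ws (dP F) = iter_partial (ws @ [True]) F" for ws
    by (simp add: iter_partial_def)
  then show ?thesis
    using assms unfolding smooth2_def by (intro allI) simp
qed

lemma smooth2_dT:
  assumes "smooth2 F"
  shows "smooth2 (dT F)"
proof -
  have "iter_partial ws (dT F) = iter_partial (ws @ [False]) F" for ws
    by (simp add: iter_partial_def)
  then show ?thesis
    using assms unfolding smooth2_def by (intro allI) simp
qed

text \<open>\<open>smooth2\<close> quantifies over all words of partial derivatives; a class stable
  under \<open>dP\<close> and \<open>dT\<close> contains every iterated partial of its members.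
  Smoothness then needs only one derivative at a time.\<close>

lemma smooth2_coinduct:
  assumes "A F"
    and step: "\<And>G. A G \<Longrightarrow> continuous_on UNIV (\<lambda>z. G (fst z) (snd z)) \<and>
      (\<forall>p t. (\<lambda>q. G q t) differentiable (at p) \<and> (\<lambda>s. G p s) differentiable (at t)) \<and>
      A (dP G) \<and> A (dT G)"
  shows "smooth2 F"
proof -
  have A: "A (iter_partial ws F)" for ws
    using \<open>A F\<close> by (induction ws) (simp_all add: iter_partial_def step)
  show ?thesis
    unfolding smooth2_def Let_def using step[OF A] by blast
qed

lemma dP_vector_eqI: "((\<lambda>q. F q t) has_vector_derivative D) (at p) \<Longrightarrow> dP F p t = D"
  by (simp add: dP_def vector_derivative_at)

lemma dP_eqI: "((\<lambda>q. f q t) has_real_derivative D) (at p) \<Longrightarrow> dP f p t = D"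
  by (simp add: dP_def has_real_derivative_iff_has_vector_derivative vector_derivative_at)

lemma dT_eqI: "((\<lambda>s. f p s) has_real_derivative D) (at t) \<Longrightarrow> dT f p t = D"
  by (simp add: dT_def has_real_derivative_iff_has_vector_derivative vector_derivative_at)

lemma smooth2_DERIV_P:
  "smooth2 f \<Longrightarrow> ((\<lambda>q. f q t) has_real_derivative dP f p t) (at p)"
  by (simp add: smooth2_has_vector_derivative_P has_real_derivative_iff_has_vector_derivative)

lemma smooth2_DERIV_T:
  "smooth2 f \<Longrightarrow> ((\<lambda>s. f p s) has_real_derivative dT f p t) (at t)"
  by (simp add: smooth2_has_vector_derivative_T has_real_derivative_iff_has_vector_derivative)

section \<open>Closure of smooth functions under linear maps and arithmetic\<close>

lemma smooth2_bounded_linear: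
  assumes h: "bounded_linear h" and F: "smooth2 F"
  shows "smooth2 (\<lambda>p t. h (F p t))" "dP (\<lambda>p t. h (F p t)) = (\<lambda>p t. h (dP F p t))"
    "dT (\<lambda>p t. h (F p t)) = (\<lambda>p t. h (dT F p t))"
proof -
  have P: "((\<lambda>q. h (G q t)) has_vector_derivative h (dP G p t)) (at p)"
    and T: "((\<lambda>s. h (G p s)) has_vector_derivative h (dT G p t)) (at t)" if "smooth2 G" for G p t
    by (intro bounded_linear.has_vector_derivative[OF h] smooth2_has_vector_derivative_P
        smooth2_has_vector_derivative_T that)+
  have dP: "dP (\<lambda>p t. h (G p t)) = (\<lambda>p t. h (dP G p t))"
    and dT: "dT (\<lambda>p t. h (G p t)) = (\<lambda>p t. h (dT G p t))" if "smooth2 G" for G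
    using P[OF that] T[OF that] by (auto simp: dP_def dT_def fun_eq_iff intro!: vector_derivative_at)
  show "dP (\<lambda>p t. h (F p t)) = (\<lambda>p t. h (dP F p t))" "dT (\<lambda>p t. h (F p t)) = (\<lambda>p t. h (dT F p t))"
    by (fact dP[OF F] dT[OF F])+
  show "smooth2 (\<lambda>p t. h (F p t))"
  proof (rule smooth2_coinduct[where A="\<lambda>H. \<exists>G. smooth2 G \<and> H = (\<lambda>p t. h (G p t))"])
    fix H assume "\<exists>G. smooth2 G \<and> H = (\<lambda>p t. h (G p t))"
    then obtain G where G: "smooth2 G" and H: "H = (\<lambda>p t. h (G p t))" by blast
    have "continuous_on UNIV (\<lambda>z. H (fst z) (snd z))"
      unfolding H by (intro bounded_linear.continuous_on[OF h] smooth2_continuous G)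
    moreover have "dP H = (\<lambda>p t. h (dP G p t))" "dT H = (\<lambda>p t. h (dT G p t))"
      unfolding H by (fact dP[OF G] dT[OF G])+
    moreover have "(\<lambda>q. H q t) differentiable (at p) \<and> (\<lambda>s. H p s) differentiable (at t)" for p t
      unfolding H using P[OF G] T[OF G] by (meson differentiableI_vector)
    ultimately show "continuous_on UNIV (\<lambda>z. H (fst z) (snd z)) \<and>
      (\<forall>p t. (\<lambda>q. H q t) differentiable (at p) \<and> (\<lambda>s. H p s) differentiable (at t)) \<and>
      (\<exists>G. smooth2 G \<and> dP H = (\<lambda>p t. h (G p t))) \<and> (\<exists>G. smooth2 G \<and> dT H = (\<lambda>p t. h (G p t)))"
      using G smooth2_dP smooth2_dT by blast
  qed (use F in blast)
qed

text \<open>The derivative of a product, inverse or root mixes several operations, so the class of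
  all such expressions is taken at once. It is the invariant for \<open>smooth2_coinduct\<close> and
  avoids Leibniz formulas of higher order.\<close>

inductive smooth2_closure :: "(real \<Rightarrow> real \<Rightarrow> real) \<Rightarrow> bool" where
  base: "smooth2 f \<Longrightarrow> smooth2_closure f"
| const: "smooth2_closure (\<lambda>p t. c)"
| add: "smooth2_closure f \<Longrightarrow> smooth2_closure g \<Longrightarrow> smooth2_closure (\<lambda>p t. f p t + g p t)"
| mult: "smooth2_closure f \<Longrightarrow> smooth2_closure g \<Longrightarrow> smooth2_closure (\<lambda>p t. f p t * g p t)"
| inverse: "smooth2_closure f \<Longrightarrow> (\<And>p t. f p t \<noteq> 0) \<Longrightarrow> smooth2_closure (\<lambda>p t. inverse (f p t))"
| sqrt: "smooth2_closure f \<Longrightarrow> (\<And>p t. f p t > 0) \<Longrightarrow> smooth2_closure (\<lambda>p t. sqrt (f p t))"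

text \<open>By the product and chain rules each derivative is again built from the constructors.
  Quotients are spelled as products with \<open>inverse\<close> so that the constructors match
  literally.\<close>

lemma smooth2_closure_step:
  assumes "smooth2_closure f"
  shows "continuous_on UNIV (\<lambda>z. f (fst z) (snd z)) \<and>
    (\<forall>p t. ((\<lambda>q. f q t) has_real_derivative dP f p t) (at p)) \<and>
    (\<forall>p t. ((\<lambda>s. f p s) has_real_derivative dT f p t) (at t)) \<and>
    smooth2_closure (dP f) \<and> smooth2_closure (dT f)"
  using assms
proof (induction f rule: smooth2_closure.induct)
  case (base f)
  then show ?case
    by (simp add: smooth2_continuous smooth2_DERIV_P smooth2_DERIV_T smooth2_closure.base
        smooth2_dP smooth2_dT)
next
  case (const c)
  have P: "((\<lambda>q. c) has_real_derivative 0) (at p)" for p by simp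
  have "dP (\<lambda>p t. c) = (\<lambda>p t. 0)" "dT (\<lambda>p t. c) = (\<lambda>p t. 0)"
    by (intro ext dP_eqI dT_eqI P)+
  then show ?case by (simp add: smooth2_closure.const)
next
  case (add f g)
  have P: "((\<lambda>q. f q t + g q t) has_real_derivative dP f p t + dP g p t) (at p)" for p t
    using add.IH by (intro DERIV_add) auto
  have T: "((\<lambda>s. f p s + g p s) has_real_derivative dT f p t + dT g p t) (at t)" for p t
    using add.IH by (intro DERIV_add) auto
  have "dP (\<lambda>p t. f p t + g p t) = (\<lambda>p t. dP f p t + dP g p t)"
    "dT (\<lambda>p t. f p t + g p t) = (\<lambda>p t. dT f p t + dT g p t)"
    by (intro ext dP_eqI dT_eqI P T)+
  then show ?case using P T add.IH
    by (simp add: continuous_on_add smooth2_closure.add)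
next
  case (mult f g)
  have P: "((\<lambda>q. f q t * g q t) has_real_derivative dP f p t * g p t + dP g p t * f p t) (at p)" for p t
    using mult.IH by (intro DERIV_mult) auto
  have T: "((\<lambda>s. f p s * g p s) has_real_derivative dT f p t * g p t + dT g p t * f p t) (at t)" for p t
    using mult.IH by (intro DERIV_mult) auto
  have "dP (\<lambda>p t. f p t * g p t) = (\<lambda>p t. dP f p t * g p t + dP g p t * f p t)"
    "dT (\<lambda>p t. f p t * g p t) = (\<lambda>p t. dT f p t * g p t + dT g p t * f p t)"
    by (intro ext dP_eqI dT_eqI P T)+
  then show ?case using P T mult.IH mult.hyps
    by (simp add: continuous_on_mult smooth2_closure.add smooth2_closure.mult)
next
  case (inverse f)
  have P: "((\<lambda>q. inverse (f q t)) has_real_derivative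
      (-1) * (inverse (f p t) * (dP f p t * inverse (f p t)))) (at p)" for p t
    using DERIV_inverse'[of "\<lambda>q. f q t" "dP f p t" p UNIV] inverse.IH inverse.hyps
    by (simp add: mult.assoc)
  have T: "((\<lambda>s. inverse (f p s)) has_real_derivative
      (-1) * (inverse (f p t) * (dT f p t * inverse (f p t)))) (at t)" for p t
    using DERIV_inverse'[of "\<lambda>s. f p s" "dT f p t" t UNIV] inverse.IH inverse.hyps
    by (simp add: mult.assoc)
  have "dP (\<lambda>p t. inverse (f p t)) = (\<lambda>p t. (-1) * (inverse (f p t) * (dP f p t * inverse (f p t))))"
    "dT (\<lambda>p t. inverse (f p t)) = (\<lambda>p t. (-1) * (inverse (f p t) * (dT f p t * inverse (f p t))))"
    by (intro ext dP_eqI dT_eqI P T)+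
  moreover have inv: "smooth2_closure (\<lambda>p t. inverse (f p t))"
    using inverse.hyps by (rule smooth2_closure.inverse)
  have "smooth2_closure (\<lambda>p t. (-1) * (inverse (f p t) * (dP f p t * inverse (f p t))))"
    "smooth2_closure (\<lambda>p t. (-1) * (inverse (f p t) * (dT f p t * inverse (f p t))))"
    by (rule smooth2_closure.mult[OF smooth2_closure.const smooth2_closure.mult[OF inv
          smooth2_closure.mult[OF _ inv]]], use inverse.IH in simp)+
  ultimately show ?case using P T inverse.IH inverse.hyps
    by (simp add: continuous_on_inverse)
next
  case (sqrt f)
  have P: "((\<lambda>q. sqrt (f q t)) has_real_derivative
      ((1/2) * inverse (sqrt (f p t))) * dP f p t) (at p)" for p t
    using DERIV_chain2[OF DERIV_real_sqrt, of "\<lambda>q. f q t" p "dP f p t" UNIV] sqrt.IH sqrt.hyps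
    by (simp add: field_simps)
  have T: "((\<lambda>s. sqrt (f p s)) has_real_derivative
      ((1/2) * inverse (sqrt (f p t))) * dT f p t) (at t)" for p t
    using DERIV_chain2[OF DERIV_real_sqrt, of "\<lambda>s. f p s" t "dT f p t" UNIV] sqrt.IH sqrt.hyps
    by (simp add: field_simps)
  have nz: "sqrt (f p t) \<noteq> 0" for p t
    using sqrt.hyps(2)[of p t] by simp
  have "dP (\<lambda>p t. sqrt (f p t)) = (\<lambda>p t. ((1/2) * inverse (sqrt (f p t))) * dP f p t)"
    "dT (\<lambda>p t. sqrt (f p t)) = (\<lambda>p t. ((1/2) * inverse (sqrt (f p t))) * dT f p t)"
    by (intro ext dP_eqI dT_eqI P T)+
  moreover have inv: "smooth2_closure (\<lambda>p t. inverse (sqrt (f p t)))"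
    using smooth2_closure.sqrt[OF sqrt.hyps] nz by (rule smooth2_closure.inverse)
  have "smooth2_closure (\<lambda>p t. ((1/2) * inverse (sqrt (f p t))) * dP f p t)"
    "smooth2_closure (\<lambda>p t. ((1/2) * inverse (sqrt (f p t))) * dT f p t)"
    by (rule smooth2_closure.mult[OF smooth2_closure.mult[OF smooth2_closure.const inv]],
        use sqrt.IH in simp)+
  ultimately show ?case using P T sqrt.IH by (simp add: continuous_on_real_sqrt)
qed

lemma smooth2_closure_imp_smooth2: "smooth2_closure f \<Longrightarrow> smooth2 f"
proof (erule smooth2_coinduct)
  fix h assume "smooth2_closure h"
  note step = smooth2_closure_step[OF this]
  then have "(\<lambda>q. h q t) differentiable at p" "(\<lambda>s. h p s) differentiable at t" for p t
    unfolding real_differentiable_def by blast+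
  then show "continuous_on UNIV (\<lambda>z. h (fst z) (snd z)) \<and>
      (\<forall>p t. (\<lambda>q. h q t) differentiable (at p) \<and> (\<lambda>s. h p s) differentiable (at t)) \<and>
      smooth2_closure (dP h) \<and> smooth2_closure (dT h)"
    using step by simp
qed

lemma smooth2_const: "smooth2 (\<lambda>p t. c :: real)"
  by (rule smooth2_closure_imp_smooth2, rule smooth2_closure.const)

lemma smooth2_add:
  fixes f g :: "real \<Rightarrow> real \<Rightarrow> real"
  shows "smooth2 f \<Longrightarrow> smooth2 g \<Longrightarrow> smooth2 (\<lambda>p t. f p t + g p t)"
  by (rule smooth2_closure_imp_smooth2, rule smooth2_closure.add; erule smooth2_closure.base)

lemma smooth2_mult:
  fixes f g :: "real \<Rightarrow> real \<Rightarrow> real"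
  shows "smooth2 f \<Longrightarrow> smooth2 g \<Longrightarrow> smooth2 (\<lambda>p t. f p t * g p t)"
  by (rule smooth2_closure_imp_smooth2, rule smooth2_closure.mult; erule smooth2_closure.base)

lemma smooth2_diff:
  fixes f g :: "real \<Rightarrow> real \<Rightarrow> real"
  assumes "smooth2 f" "smooth2 g"
  shows "smooth2 (\<lambda>p t. f p t - g p t)"
  using smooth2_add[OF assms(1) smooth2_mult[OF smooth2_const[of "-1"] assms(2)]] by simp

lemma smooth2_divide:
  fixes f g :: "real \<Rightarrow> real \<Rightarrow> real"
  shows "smooth2 f \<Longrightarrow> smooth2 g \<Longrightarrow> (\<And>p t. g p t \<noteq> 0) \<Longrightarrow> smooth2 (\<lambda>p t. f p t / g p t)"
  unfolding divide_inverse
  by (rule smooth2_closure_imp_smooth2, rule smooth2_closure.mult, erule smooth2_closure.base,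
      rule smooth2_closure.inverse, erule smooth2_closure.base)

lemma smooth2_sqrt: "smooth2 f \<Longrightarrow> (\<And>p t. f p t > 0) \<Longrightarrow> smooth2 (\<lambda>p t. sqrt (f p t))"
  by (rule smooth2_closure_imp_smooth2, rule smooth2_closure.sqrt, erule smooth2_closure.base)

lemma smooth2_power:
  fixes f :: "real \<Rightarrow> real \<Rightarrow> real"
  shows "smooth2 f \<Longrightarrow> smooth2 (\<lambda>p t. f p t ^ n)"
  by (induction n) (simp_all add: smooth2_const smooth2_mult)

lemmas smooth2_intros = smooth2_const smooth2_add smooth2_mult smooth2_diff smooth2_divide
  smooth2_power smooth2_dP smooth2_dT

lemma dP_add:
  fixes f g :: "real \<Rightarrow> real \<Rightarrow> real"
  shows "smooth2 f \<Longrightarrow> smooth2 g \<Longrightarrow> dP (\<lambda>p t. f p t + g p t) = (\<lambda>p t. dP f p t + dP g p t)"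
  by (intro ext dP_eqI DERIV_add smooth2_DERIV_P)

lemma dP_cmult:
  fixes f :: "real \<Rightarrow> real \<Rightarrow> real"
  shows "smooth2 f \<Longrightarrow> dP (\<lambda>p t. c * f p t) = (\<lambda>p t. c * dP f p t)"
  by (intro ext dP_eqI DERIV_cmult smooth2_DERIV_P)

lemma dP_mult:
  fixes f g :: "real \<Rightarrow> real \<Rightarrow> real"
  shows "smooth2 f \<Longrightarrow> smooth2 g \<Longrightarrow>
    dP (\<lambda>p t. f p t * g p t) = (\<lambda>p t. dP f p t * g p t + f p t * dP g p t)"
  by (intro ext dP_eqI DERIV_cong[OF DERIV_mult[OF smooth2_DERIV_P smooth2_DERIV_P]]) simp_all

section \<open>Integrals of smooth functions and mixed partial derivatives\<close>

lemma smooth2_continuous_P: "smooth2 f \<Longrightarrow> continuous_on A (\<lambda>p. f p t)"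
  using continuous_on_compose2[OF smooth2_continuous, of f A "\<lambda>p. (p, t)"]
  by (simp add: continuous_on_Pair)

lemma DERIV_integral_smooth2:
  fixes f :: "real \<Rightarrow> real \<Rightarrow> real"
  assumes f: "smooth2 f"
  shows "((\<lambda>t. integral {a..b} (\<lambda>p. f p t)) has_real_derivative integral {a..b} (\<lambda>p. dT f p t)) (at t)"
proof -
  \<comment> \<open>The Leibniz rule wants the time parameter in the first coordinate, hence the
    swap of arguments.\<close>
  have "continuous_on (UNIV \<times> {a..b}) (\<lambda>(s, p). dT f p s)"
    using continuous_on_compose2[OF smooth2_continuous[OF smooth2_dT[OF f]], of "UNIV \<times> {a..b}" "\<lambda>z. (snd z, fst z)"]
    by (simp add: continuous_intros split_beta)
  then show ?thesis
    using leibniz_rule_field_derivative[of UNIV a b "\<lambda>s p. f p s" "\<lambda>s p. dT f p s" t]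
    by (simp add: smooth2_DERIV_T f integrable_continuous_interval smooth2_continuous_P)
qed

lemma integral_dP:
  fixes f :: "real \<Rightarrow> real \<Rightarrow> real"
  assumes f: "smooth2 f" and "a \<le> b"
  shows "integral {a..b} (\<lambda>p. dP f p t) = f b t - f a t"
  by (intro integral_unique fundamental_theorem_of_calculus[of a b "\<lambda>p. f p t"] assms
      has_vector_derivative_at_within[OF smooth2_has_vector_derivative_P])

text \<open>Both mixed derivatives are read off from differentiating
  \<open>f q t - f a t = \<integral>\<^sub>a\<^sup>q f\<^sub>p\<close> under the integral sign.\<close>
lemma dP_dT_commute:
  fixes f :: "real \<Rightarrow> real \<Rightarrow> real"
  assumes f: "smooth2 f"
  shows "dP (dT f) = dT (dP f)"
proof (intro ext dP_eqI)
  fix p t :: real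
  define a b where "a = p - 1" and "b = p + 1"
  have eq: "dT f q t = dT f a t + integral {a..q} (\<lambda>r. dT (dP f) r t)" if "q \<in> {a..b}" for q
  proof -
    have "a \<le> q" using that by simp
    have "((\<lambda>s. f q s - f a s) has_real_derivative dT f q t - dT f a t) (at t)"
      by (intro DERIV_diff smooth2_DERIV_T f)
    then have "((\<lambda>s. integral {a..q} (\<lambda>r. dP f r s)) has_real_derivative dT f q t - dT f a t) (at t)"
      by (simp only: integral_dP[OF f \<open>a \<le> q\<close>])
    from DERIV_unique[OF this DERIV_integral_smooth2[OF smooth2_dP[OF f]]] show ?thesis
      by linarith
  qed
  have "((\<lambda>q. integral {a..q} (\<lambda>r. dT (dP f) r t)) has_real_derivative dT (dP f) p t) (at p within {a..b})"
    by (intro integral_has_real_derivative smooth2_continuous_P smooth2_dT smooth2_dP f)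
      (simp add: a_def b_def)
  moreover have "at p within {a..b} = at p"
    by (rule at_within_interior) (simp add: a_def b_def)
  ultimately have "((\<lambda>q. dT f a t + integral {a..q} (\<lambda>r. dT (dP f) r t)) has_real_derivative
      0 + dT (dP f) p t) (at p)"
    by (intro DERIV_add DERIV_const) simp
  then show "((\<lambda>q. dT f q t) has_real_derivative dT (dP f) p t) (at p)"
    unfolding add_0_left
    by (rule has_field_derivative_transform_within_open[where S="{a<..<b}"])
      (simp_all add: a_def b_def eq[symmetric, unfolded a_def b_def])
qed

section \<open>Decay at minus infinity from differential inequalities\<close>

text \<open>For nonnegative \<open>f\<close> this says that \<open>f\<close> is integrable towards
  minus infinity: the antiderivative is then monotone, and a lower bound makes it converge there.
  Improper integrals are avoided.\<close>

definition antideriv_bdd_below :: "(real \<Rightarrow> real) \<Rightarrow> bool" where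
  "antideriv_bdd_below f \<longleftrightarrow> (\<exists>F B. \<forall>t. (F has_real_derivative f t) (at t) \<and> B \<le> F t)"

lemma antideriv_bdd_below_add:
  assumes "antideriv_bdd_below f" "antideriv_bdd_below g"
  shows "antideriv_bdd_below (\<lambda>t. f t + g t)"
proof -
  obtain F A G B where F: "\<And>t. (F has_real_derivative f t) (at t)" "\<And>t. A \<le> F t"
    and G: "\<And>t. (G has_real_derivative g t) (at t)" "\<And>t. B \<le> G t"
    using assms unfolding antideriv_bdd_below_def by metis
  have "((\<lambda>t. F t + G t) has_real_derivative f t + g t) (at t) \<and> A + B \<le> F t + G t" for t
    by (intro conjI DERIV_add add_mono F G)
  then show ?thesis unfolding antideriv_bdd_below_def by blast
qed

lemma antideriv_bdd_below_sum:
  "(\<And>j. j \<le> k \<Longrightarrow> antideriv_bdd_below (f j)) \<Longrightarrow> antideriv_bdd_below (\<lambda>t. \<Sum>j\<le>k. f j t)" for k :: nat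
  by (induction k) (simp_all add: antideriv_bdd_below_add)

lemma DERIV_nonneg_imp_mono:
  fixes F :: "real \<Rightarrow> real"
  assumes "\<And>t. (F has_real_derivative f t) (at t)" "\<And>t. 0 \<le> f t" "s \<le> t"
  shows "F s \<le> F t"
  using assms by (meson DERIV_nonneg_imp_nondecreasing)

text \<open>Let \<open>I\<close> be an antiderivative of \<open>S\<close>. The unit window ending at
  \<open>t\<close> contains a time \<open>s\<close> where \<open>S\<close>, hence \<open>E\<close>,
  is at most the increment of \<open>I\<close> over the window; from \<open>s\<close> to
  \<open>t\<close> the function \<open>E\<close> grows by at most \<open>K\<close> times that
  increment. The increments tend to 0 because \<open>I\<close> is monotone and bounded
  below.\<close>

lemma past_decay:
  fixes E S G :: "real \<Rightarrow> real"
  assumes S: "antideriv_bdd_below S"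
    and E: "\<And>t. 0 \<le> E t" "\<And>t. E t \<le> S t"
    and G: "\<And>t. 0 \<le> G t"
    and K: "0 \<le> K"
    and ineq: "\<And>t. t \<le> T \<Longrightarrow> \<exists>D. (E has_real_derivative D) (at t) \<and> D \<le> K * S t - G t"
  shows "(E \<longlongrightarrow> 0) at_bot"
proof -
  obtain I B where I: "\<And>t. (I has_real_derivative S t) (at t)" and B: "\<And>t. B \<le> I t"
    using S unfolding antideriv_bdd_below_def by metis
  have S0: "0 \<le> S t" for t using E[of t] by linarith
  have I_mono: "I s \<le> I t" if "s \<le> t" for s t
    using DERIV_nonneg_imp_mono[OF I S0 that] .
  have bound: "E t \<le> (1 + K) * (I t - I (t - 1))" if "t \<le> T" for t
  proof -
    obtain s where s: "t - 1 < s" "s < t" and S_s: "I t - I (t - 1) = (t - (t - 1)) * S s"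
      using MVT2[of "t - 1" t I S] I by auto
    have "E t - K * I t \<le> E s - K * I s"
    proof (rule DERIV_nonpos_imp_nonincreasing[OF less_imp_le[OF s(2)]])
      fix x assume "s \<le> x" "x \<le> t"
      with that obtain D where D: "(E has_real_derivative D) (at x)" "D \<le> K * S x - G x"
        using ineq[of x] by auto
      have "((\<lambda>x. E x - K * I x) has_real_derivative D - K * S x) (at x)"
        by (intro DERIV_diff D DERIV_cmult I)
      moreover have "D - K * S x \<le> 0" using D(2) G[of x] by linarith
      ultimately show "\<exists>y. ((\<lambda>x. E x - K * I x) has_real_derivative y) (at x) \<and> y \<le> 0" by blast
    qed
    moreover have "K * I (t - 1) \<le> K * I s"
      by (intro mult_left_mono K I_mono) (use s in simp)
    ultimately show ?thesis
      using E(2)[of s] S_s by (simp add: algebra_simps)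
  qed
  show ?thesis
  proof (rule tendstoI)
    fix e :: real assume "0 < e"
    \<comment> \<open>\<open>l\<close> is the limit of \<open>I\<close> at minus infinity; up to
      time \<open>t0\<close> the values of \<open>I\<close> stay within \<open>e / (1 + K)\<close>
      of it.\<close>
    define l where "l = Inf (range I)"
    have bdd: "bdd_below (range I)" by (rule bdd_belowI2) (rule B)
    have "l < l + e / (1 + K)" using \<open>0 < e\<close> K by simp
    then obtain t0 where t0: "I t0 < l + e / (1 + K)"
      using cInf_lessD[of "range I" "l + e / (1 + K)"] by (auto simp: l_def)
    have "dist (E t) 0 < e" if "t \<le> min t0 T" for t
    proof -
      have "l \<le> I (t - 1)" unfolding l_def by (rule cInf_lower[OF _ bdd]) simp
      moreover have "I t \<le> I t0" using that I_mono by simp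
      ultimately have "I t - I (t - 1) < e / (1 + K)" using t0 by linarith
      then have "(1 + K) * (I t - I (t - 1)) < (1 + K) * (e / (1 + K))"
        using K by (intro mult_strict_left_mono) auto
      also have "\<dots> = e" using K by simp
      finally show ?thesis using bound[of t] that E(1)[of t] by simp
    qed
    then show "\<forall>\<^sub>F t in at_bot. dist (E t) 0 < e"
      unfolding eventually_at_bot_linorder by blast
  qed
qed

text \<open>With \<open>J\<close> an antiderivative of \<open>G\<close>, the inequality makes
  \<open>E + J - K * I\<close> nonincreasing. Going back in time, \<open>J\<close> can therefore
  fall only as far as \<open>E - K * I\<close> can rise, and the latter is bounded above.\<close>

lemma past_gain:
  fixes E S G :: "real \<Rightarrow> real"
  assumes S: "antideriv_bdd_below S"
    and E: "(E \<longlongrightarrow> 0) at_bot"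
    and G: "\<And>t. 0 \<le> G t" "continuous_on UNIV G"
    and K: "0 \<le> K"
    and ineq: "\<And>t. t \<le> T \<Longrightarrow> \<exists>D. (E has_real_derivative D) (at t) \<and> D \<le> K * S t - G t"
  shows "antideriv_bdd_below G"
proof -
  obtain I B where I: "\<And>t. (I has_real_derivative S t) (at t)" and B: "\<And>t. B \<le> I t"
    using S unfolding antideriv_bdd_below_def by metis
  have "\<exists>F. \<forall>x::real. -\<infinity> < ereal x \<longrightarrow> ereal x < \<infinity> \<longrightarrow> (F has_vector_derivative G x) (at x)"
    by (rule einterval_antiderivative)
      (use G(2) in \<open>simp_all add: continuous_on_eq_continuous_at\<close>)
  then obtain J where J: "\<And>t. (J has_real_derivative G t) (at t)"
    by (auto simp: has_real_derivative_iff_has_vector_derivative)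
  have "\<forall>\<^sub>F t in at_bot. E t < 1"
    using order_tendstoD(2)[OF E, of 1] by simp
  then obtain T1 where T1: "\<And>t. t \<le> T1 \<Longrightarrow> E t < 1"
    unfolding eventually_at_bot_linorder by blast
  define b where "b = min T T1"
  \<comment> \<open>The value of the nonincreasing quantity at \<open>b\<close>, corrected by
    \<open>K * B\<close> for the term \<open>K * I t\<close> and by 1 for
    \<open>E t\<close>.\<close>
  define c where "c = E b + J b - K * I b + K * B - 1"
  have low: "c \<le> J t" if "t \<le> b" for t
  proof -
    have "E b + J b - K * I b \<le> E t + J t - K * I t"
    proof (rule DERIV_nonpos_imp_nonincreasing[OF that])
      fix x assume "t \<le> x" "x \<le> b"
      then obtain D where D: "(E has_real_derivative D) (at x)" "D \<le> K * S x - G x"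
        using ineq[of x] by (auto simp: b_def)
      have "((\<lambda>x. E x + J x - K * I x) has_real_derivative D + G x - K * S x) (at x)"
        by (intro DERIV_diff DERIV_add D DERIV_cmult I J)
      moreover have "D + G x - K * S x \<le> 0" using D(2) by linarith
      ultimately show "\<exists>y. ((\<lambda>x. E x + J x - K * I x) has_real_derivative y) (at x) \<and> y \<le> 0" by blast
    qed
    moreover have "K * B \<le> K * I t" by (intro mult_left_mono B K)
    moreover have "E t < 1" using T1 that by (simp add: b_def)
    ultimately show ?thesis unfolding c_def by linarith
  qed
  have "c \<le> J t" for t
  proof (cases "t \<le> b")
    case False
    then show ?thesis using low[of b] DERIV_nonneg_imp_mono[OF J G(1), of b t] by simp
  qed (rule low)
  then show ?thesis using J unfolding antideriv_bdd_below_def by blast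
qed

section \<open>Energies of the curvature\<close>

definition periodic2 :: "(real \<Rightarrow> real \<Rightarrow> real) \<Rightarrow> bool" where
  "periodic2 f \<longleftrightarrow> (\<forall>p t. f (p + 2 * pi) t = f p t)"

lemma periodic2_dP:
  assumes "smooth2 f" "periodic2 f"
  shows "periodic2 (dP f)"
  unfolding periodic2_def
proof (intro allI)
  fix p t
  have "((\<lambda>q. f (q + 2 * pi) t) has_real_derivative dP f (p + 2 * pi) t) (at p)"
    by (rule DERIV_shift[THEN iffD1]) (rule smooth2_DERIV_P[OF assms(1)])
  then show "dP f (p + 2 * pi) t = dP f p t"
    using assms(2) DERIV_unique[OF _ smooth2_DERIV_P[OF assms(1)]] by (simp add: periodic2_def)
qed

text \<open>The number of periods to subtract depends on \<open>p\<close> and \<open>a\<close> only,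
  so one representative \<open>q\<close> serves all times.\<close>

lemma periodic2_reduce:
  assumes f: "periodic2 f"
  obtains q where "a \<le> q" "q < a + 2 * pi" "\<And>t. f q t = f p t"
proof -
  have up: "f (p + 2 * pi * real n) t = f p t" for n p t
  proof (induction n)
    case (Suc n)
    have "p + 2 * pi * real (Suc n) = p + 2 * pi * real n + 2 * pi" by (simp add: algebra_simps)
    with Suc show ?case using f unfolding periodic2_def by metis
  qed simp
  have all: "f (p + 2 * pi * of_int m) t = f p t" for m t
  proof (cases "0 \<le> m")
    case True
    then show ?thesis using up[of p "nat m" t] by simp
  next
    case False
    then show ?thesis using up[of "p + 2 * pi * of_int m" "nat (- m)" t] by simp
  qed
  define m where "m = \<lfloor>(p - a) / (2 * pi)\<rfloor>"
  have "of_int m \<le> (p - a) / (2 * pi)" "(p - a) / (2 * pi) < of_int m + 1"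
    unfolding m_def by linarith+
  then have "2 * pi * of_int m \<le> p - a" "p - a < 2 * pi * of_int m + 2 * pi"
    by (simp_all add: field_simps)
  then show ?thesis
    using that[of "p + 2 * pi * of_int (- m)"] all[of "- m"] by simp
qed

section \<open>Arc-length derivatives and the abstract evolution\<close>

definition arc_deriv :: "(real \<Rightarrow> real \<Rightarrow> real) \<Rightarrow> (real \<Rightarrow> real \<Rightarrow> real) \<Rightarrow> real \<Rightarrow> real \<Rightarrow> real" where
  "arc_deriv g f = (\<lambda>p t. dP f p t / g p t)"

text \<open>Homogeneous cubic forms whose weight \<open>k\<close> counts arc-length derivatives. The
  coefficients of the reaction terms are left unspecified, since the estimates depend only on degree
  and weight.\<close>

inductive cubic :: "(nat \<Rightarrow> real \<Rightarrow> real \<Rightarrow> real) \<Rightarrow> nat \<Rightarrow> (real \<Rightarrow> real \<Rightarrow> real) \<Rightarrow> bool" for u where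
  monomial: "a + b + c = k \<Longrightarrow> cubic u k (\<lambda>p t. u a p t * u b p t * u c p t)"
| add: "cubic u k f \<Longrightarrow> cubic u k h \<Longrightarrow> cubic u k (\<lambda>p t. f p t + h p t)"
| scale: "cubic u k f \<Longrightarrow> cubic u k (\<lambda>p t. r * f p t)"

text \<open>The analytic half of the argument: the curve is forgotten, and only metric, curvature
  and their evolution are kept. \<open>phi_zero\<close> starts the pointwise estimates, because
  nothing here presents \<open>phi\<close> itself as a derivative of a periodic function.\<close>

locale curvature_evolution =
  fixes g phi :: "real \<Rightarrow> real \<Rightarrow> real" and M :: real
  assumes smooth_g: "smooth2 g" and g_pos: "\<And>p t. 0 < g p t" and periodic_g: "periodic2 g"
    and smooth_phi: "smooth2 phi" and periodic_phi: "periodic2 phi"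
    and dT_g: "\<And>p t. dT g p t = (phi p t)\<^sup>2 / 2 * g p t"
    and dT_phi: "\<And>p t. dT phi p t =
      arc_deriv g (arc_deriv g phi) p t / 2 + 2 * phi p t - phi p t ^ 3 / 2"
    and phi_zero: "\<And>t. \<exists>p. phi p t = 0"
    and phi_bound: "\<And>p t. \<bar>phi p t\<bar> \<le> M"
begin

abbreviation "D \<equiv> arc_deriv g"

definition "psi k = (D ^^ k) phi"

definition "arc_int f t = integral {0..2 * pi} (\<lambda>p. f p t * g p t)"

definition "energy k = arc_int (\<lambda>p t. (psi k p t)\<^sup>2)"

lemma psi_0 [simp]: "psi 0 = phi" by (simp add: psi_def)

lemma D_psi [simp]: "D (psi k) = psi (Suc k)" by (simp add: psi_def)

lemma g_nz [simp]: "g p t \<noteq> 0" using g_pos[of p t] by simp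

lemma smooth_D: "smooth2 f \<Longrightarrow> smooth2 (D f)"
  unfolding arc_deriv_def by (intro smooth2_divide smooth2_dP smooth_g) auto

lemma periodic_D: "smooth2 f \<Longrightarrow> periodic2 f \<Longrightarrow> periodic2 (D f)"
  using periodic2_dP[of f] periodic_g by (simp add: arc_deriv_def periodic2_def)

lemma psi_smooth_periodic: "smooth2 (psi k) \<and> periodic2 (psi k)"
  by (induction k) (auto simp: smooth_phi periodic_phi smooth_D periodic_D simp flip: D_psi)

lemmas smooth_psi = conjunct1[OF psi_smooth_periodic]
lemmas periodic_psi = conjunct2[OF psi_smooth_periodic]

lemma D_add: "smooth2 f \<Longrightarrow> smooth2 h \<Longrightarrow> D (\<lambda>p t. f p t + h p t) = (\<lambda>p t. D f p t + D h p t)"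
  unfolding arc_deriv_def by (simp add: dP_add add_divide_distrib)

lemma D_cmult: "smooth2 f \<Longrightarrow> D (\<lambda>p t. r * f p t) = (\<lambda>p t. r * D f p t)"
  unfolding arc_deriv_def by (simp add: dP_cmult)

lemma D_mult:
  "smooth2 f \<Longrightarrow> smooth2 h \<Longrightarrow> D (\<lambda>p t. f p t * h p t) = (\<lambda>p t. D f p t * h p t + f p t * D h p t)"
  unfolding arc_deriv_def by (simp add: dP_mult add_divide_distrib)

text \<open>Mixed partials in \<open>p\<close> and \<open>t\<close> commute, so the commutator comes
  entirely from the factor \<open>1 / g\<close>, through \<open>dT_g\<close>.\<close>

lemma dT_D:
  assumes f: "smooth2 f"
  shows "dT (D f) p t = D (dT f) p t - (phi p t)\<^sup>2 / 2 * D f p t"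
proof -
  have "dT (\<lambda>p s. dP f p s / g p s) p t =
      (dT (dP f) p t * g p t - dP f p t * dT g p t) / (g p t * g p t)"
    by (intro dT_eqI DERIV_divide smooth2_DERIV_T smooth2_dP f smooth_g) simp
  also have "\<dots> = dT (dP f) p t / g p t - (phi p t)\<^sup>2 / 2 * (dP f p t / g p t)"
    by (simp add: dT_g field_simps)
  finally show ?thesis
    by (simp add: arc_deriv_def dP_dT_commute[OF f])
qed

lemma smooth_cubic: "cubic psi k f \<Longrightarrow> smooth2 f"
  by (induction rule: cubic.induct) (simp_all add: smooth2_intros smooth_psi)

lemma cubic_D: "cubic psi k f \<Longrightarrow> cubic psi (Suc k) (D f)"
proof (induction rule: cubic.induct)
  case (monomial a b c k)
  have "D (\<lambda>p t. psi a p t * psi b p t * psi c p t) = (\<lambda>p t. (psi (Suc a) p t * psi b p t * psi c p t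
      + psi a p t * psi (Suc b) p t * psi c p t) + psi a p t * psi b p t * psi (Suc c) p t)"
    by (simp add: D_mult smooth2_mult smooth_psi algebra_simps)
  then show ?case
    using monomial by (auto intro!: cubic.add cubic.monomial)
next
  case (add k f h)
  then show ?case by (simp add: D_add smooth_cubic cubic.add)
next
  case (scale k f r)
  then show ?case by (simp add: D_cmult smooth_cubic cubic.scale)
qed

text \<open>Induction by applying \<open>D\<close>. The linear part keeps its shape, the cubic
  remainder moves up one weight, and the commutator adds a multiple of \<open>phi\<^sup>2\<close>
  times \<open>psi (Suc k)\<close>, which is cubic of weight \<open>Suc k\<close> as well.\<close>

lemma psi_evolution:
  "\<exists>R. cubic psi k R \<and> dT (psi k) = (\<lambda>p t. (1/2) * psi (Suc (Suc k)) p t + 2 * psi k p t + R p t)"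
proof (induction k)
  case 0
  have "cubic psi 0 (\<lambda>p t. (-1/2) * (psi 0 p t * psi 0 p t * psi 0 p t))"
    by (intro cubic.scale cubic.monomial) simp
  moreover have "dT (psi 0) = (\<lambda>p t. (1/2) * psi (Suc (Suc 0)) p t + 2 * psi 0 p t
      + (-1/2) * (psi 0 p t * psi 0 p t * psi 0 p t))"
    by (intro ext) (simp add: dT_phi power3_eq_cube flip: D_psi)
  ultimately show ?case by blast
next
  case (Suc k)
  then obtain R where R: "cubic psi k R"
    and dT: "dT (psi k) = (\<lambda>p t. (1/2) * psi (Suc (Suc k)) p t + 2 * psi k p t + R p t)"
    by blast
  let ?R = "\<lambda>p t. D R p t + (-1/2) * (psi 0 p t * psi 0 p t * psi (Suc k) p t)"
  have "cubic psi (Suc k) ?R"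
    by (intro cubic.add cubic_D R cubic.scale cubic.monomial) simp
  moreover have sm: "smooth2 (\<lambda>p t. r * psi j p t)" for r j
    by (intro smooth2_mult smooth2_const smooth_psi)
  have "D (dT (psi k)) = (\<lambda>p t. (1/2) * psi (Suc (Suc (Suc k))) p t + 2 * psi (Suc k) p t + D R p t)"
    unfolding dT by (simp only: D_add[OF smooth2_add] D_add D_cmult sm smooth_psi smooth_cubic[OF R] D_psi)
  then have "dT (psi (Suc k)) = (\<lambda>p t. (1/2) * psi (Suc (Suc (Suc k))) p t + 2 * psi (Suc k) p t + ?R p t)"
    using dT_D[OF smooth_psi, of k] by (auto simp: fun_eq_iff power2_eq_square)
  ultimately show ?case by blast
qed

section \<open>Integration along the curve\<close>

lemma arc_integrable: "smooth2 f \<Longrightarrow> (\<lambda>p. f p t * g p t) integrable_on {a..b}"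
  by (intro integrable_continuous_interval smooth2_continuous_P smooth2_mult smooth_g)

lemma arc_int_add:
  "smooth2 f \<Longrightarrow> smooth2 h \<Longrightarrow> arc_int (\<lambda>p t. f p t + h p t) t = arc_int f t + arc_int h t"
  unfolding arc_int_def by (simp add: distrib_right integral_add arc_integrable)

lemma arc_int_cmult: "arc_int (\<lambda>p t. r * f p t) t = r * arc_int f t"
  unfolding arc_int_def by (simp add: mult.assoc)

lemma arc_int_mono:
  "smooth2 f \<Longrightarrow> smooth2 h \<Longrightarrow> (\<And>p. f p t \<le> h p t) \<Longrightarrow> arc_int f t \<le> arc_int h t"
  unfolding arc_int_def
  by (intro integral_le arc_integrable) (simp_all add: mult_right_mono less_imp_le[OF g_pos])

lemma arc_int_abs_le:
  assumes f: "smooth2 f" and h: "smooth2 h" and le: "\<And>p. \<bar>f p t\<bar> \<le> h p t"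
  shows "\<bar>arc_int f t\<bar> \<le> arc_int h t"
proof -
  have "arc_int f t \<le> arc_int h t"
    by (intro arc_int_mono f h) (meson le abs_le_D1)
  moreover have "arc_int (\<lambda>p t. (-1) * f p t) t \<le> arc_int h t"
    using le by (intro arc_int_mono smooth2_mult smooth2_const f h) (simp add: abs_le_iff)
  then have "- arc_int f t \<le> arc_int h t" unfolding arc_int_cmult by simp
  ultimately show ?thesis by (rule abs_leI)
qed

text \<open>The metric in the arc element cancels the one in \<open>D\<close>, leaving a derivative
  integrated over one period. Applied to a product, this is integration by parts without boundary
  terms.\<close>

lemma arc_int_D:
  assumes f: "smooth2 f" "periodic2 f"
  shows "arc_int (D f) t = 0"
proof -
  have "f (2 * pi) t = f 0 t" using f(2)[unfolded periodic2_def, rule_format, of 0] by simp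
  then show ?thesis
    unfolding arc_int_def arc_deriv_def using integral_dP[OF f(1), of 0 "2 * pi" t] by simp
qed

text \<open>The additional term is the change of the arc element, given by
  \<open>dT_g\<close>.\<close>

lemma DERIV_arc_int:
  assumes f: "smooth2 f"
  shows "(arc_int f has_real_derivative arc_int (\<lambda>p t. dT f p t + (phi p t)\<^sup>2 / 2 * f p t) t) (at t)"
proof -
  have "((\<lambda>s. f p s * g p s) has_real_derivative dT f p t * g p t + dT g p t * f p t) (at t)" for p t
    by (intro DERIV_mult smooth2_DERIV_T f smooth_g)
  then have "dT (\<lambda>p t. f p t * g p t) p t = (dT f p t + (phi p t)\<^sup>2 / 2 * f p t) * g p t" for p t
    by (simp add: dT_eqI dT_g algebra_simps)
  then show ?thesis
    using DERIV_integral_smooth2[OF smooth2_mult[OF f smooth_g], of 0 "2 * pi" t]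
    unfolding arc_int_def by simp
qed

section \<open>Energies, pointwise bounds and cubic terms\<close>

lemma smooth_psi_power: "smooth2 (\<lambda>p t. (psi k p t)\<^sup>2)"
  by (intro smooth2_power smooth_psi)

lemma energy_nonneg: "0 \<le> energy k t"
  unfolding energy_def arc_int_def
  by (intro integral_nonneg arc_integrable smooth_psi_power)
    (simp add: less_imp_le[OF g_pos])

lemma energy_continuous: "continuous_on UNIV (energy k)"
  unfolding energy_def
  by (intro continuous_at_imp_continuous_on ballI DERIV_isCont[OF DERIV_arc_int] smooth_psi_power)

lemma energy_le_sum: "j \<le> k \<Longrightarrow> energy j t \<le> (\<Sum>i\<le>k. energy i t)"
  by (rule member_le_sum) (simp_all add: energy_nonneg)

text \<open>Derivatives of positive order vanish somewhere by Rolle's theorem over one period; order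
  zero is the hypothesis \<open>phi_zero\<close>.\<close>

lemma psi_zero: "\<exists>z. psi k z t = 0"
proof (cases k)
  case 0
  then show ?thesis using phi_zero by simp
next
  case (Suc j)
  have "psi j 0 t = psi j (2 * pi) t"
    using periodic_psi[of j, unfolded periodic2_def, rule_format, of 0] by simp
  moreover have "(\<lambda>q. psi j q t) differentiable at z" for z
    using smooth2_DERIV_P[OF smooth_psi] unfolding real_differentiable_def by blast
  ultimately obtain z where "DERIV (\<lambda>q. psi j q t) z :> 0"
    using Rolle[of 0 "2 * pi" "\<lambda>q. psi j q t"] smooth2_continuous_P[OF smooth_psi] by auto
  then have "dP (psi j) z t = 0" by (rule dP_eqI)
  then show ?thesis using Suc by (auto simp: arc_deriv_def simp flip: D_psi)
qed

text \<open>The arc-length derivative of the square is twice \<open>psi k * psi (Suc k)\<close>,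
  hence at most the sum of the two squares. Working with squares gives the constant 1, whatever the
  length of the curve.\<close>

lemma psi_variation:
  assumes "0 \<le> a" "a \<le> b" "b \<le> 2 * pi"
  shows "\<bar>(psi k b t)\<^sup>2 - (psi k a t)\<^sup>2\<bar> \<le> energy k t + energy (Suc k) t"
proof -
  let ?f = "\<lambda>p t. (psi k p t)\<^sup>2" and ?h = "\<lambda>p t. (psi k p t)\<^sup>2 + (psi (Suc k) p t)\<^sup>2"
  have h: "smooth2 ?h" by (intro smooth2_add smooth_psi_power)
  have "D (\<lambda>p t. psi k p t * psi k p t) p t = 2 * psi k p t * psi (Suc k) p t" for p
    by (simp add: D_mult smooth_psi)
  then have df: "dP ?f p t = 2 * psi k p t * psi (Suc k) p t * g p t" for p
    unfolding arc_deriv_def power2_eq_square by (simp add: field_simps)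
  have "\<bar>?f b t - ?f a t\<bar> = norm (integral {a..b} (\<lambda>p. dP ?f p t))"
    by (simp add: integral_dP[OF smooth_psi_power] assms)
  also have "\<dots> \<le> integral {a..b} (\<lambda>p. ?h p t * g p t)"
  proof (rule integral_norm_bound_integral)
    show "(\<lambda>p. dP ?f p t) integrable_on {a..b}"
      by (intro integrable_continuous_interval smooth2_continuous_P smooth2_dP smooth_psi_power)
    show "(\<lambda>p. ?h p t * g p t) integrable_on {a..b}" by (intro arc_integrable h)
    fix p
    have "\<bar>2 * psi k p t * psi (Suc k) p t\<bar> \<le> ?h p t"
      using sum_squares_bound[of "\<bar>psi k p t\<bar>" "\<bar>psi (Suc k) p t\<bar>"] by (simp add: abs_mult)
    then show "norm (dP ?f p t) \<le> ?h p t * g p t"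
      unfolding df real_norm_def by (simp add: abs_mult[of _ "g p t"] less_imp_le[OF g_pos] mult_right_mono)
  qed
  also have "\<dots> \<le> arc_int ?h t"
    unfolding arc_int_def using assms
    by (intro integral_subset_le arc_integrable h) (auto simp: less_imp_le[OF g_pos])
  also have "\<dots> = energy k t + energy (Suc k) t"
    unfolding energy_def by (intro arc_int_add smooth_psi_power)
  finally show ?thesis .
qed

text \<open>The variation is measured from a zero of \<open>psi k\<close>; periodicity brings this
  zero and the given point into the same period.\<close>

lemma psi_sup: "(psi k p t)\<^sup>2 \<le> energy k t + energy (Suc k) t"
proof -
  obtain z0 where "psi k z0 t = 0" using psi_zero by blast
  then obtain z where z: "0 \<le> z" "z \<le> 2 * pi" "psi k z t = 0"
    using periodic2_reduce[OF periodic_psi, of 0 k z0] by (metis add_0 less_imp_le)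
  obtain q where q: "0 \<le> q" "q \<le> 2 * pi" "psi k q t = psi k p t"
    using periodic2_reduce[OF periodic_psi, of 0 k p] by (metis add_0 less_imp_le)
  show ?thesis
    using psi_variation[of q z k t] psi_variation[of z q k t] z q by (cases "z \<le> q") auto
qed

text \<open>The smallest index \<open>a\<close> is bounded pointwise by a constant, since either \<open>a = 0\<close> or both energies
  controlling \<open>psi a\<close> are at most 1; \<open>psi b\<close> is bounded pointwise by the sum of the energies.\<close>
lemma monomial_bound_aux:
  assumes k: "a + b + c = k" and ab: "a \<le> b" "a \<le> c" and bc: "b < k" "c < k"
    and E: "\<And>j. j < k \<Longrightarrow> energy j t \<le> 1"
  shows "\<bar>arc_int (\<lambda>p t. psi k p t * (psi a p t * psi b p t * psi c p t)) t\<bar>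
    \<le> (M\<^sup>2 + 3) * (\<Sum>i\<le>k. energy i t)"
proof -
  define S where "S = (\<Sum>i\<le>k. energy i t)"
  have S0: "0 \<le> S" unfolding S_def by (intro sum_nonneg energy_nonneg)
  have ES: "energy j t \<le> S" if "j \<le> k" for j unfolding S_def using that by (rule energy_le_sum)
  have A: "(psi a p t)\<^sup>2 \<le> M\<^sup>2 + 2" for p
  proof (cases "a = 0")
    case True
    have "(phi p t)\<^sup>2 \<le> M\<^sup>2" by (rule abs_le_square_iff[THEN iffD1]) (use phi_bound[of p t] in simp)
    then show ?thesis using True by simp
  next
    case False
    \<comment> \<open>A smallest index \<open>a > 0\<close> gives \<open>3 * a \<le> k\<close>, so
      the hypothesis on the energies covers \<open>Suc a\<close> too.\<close>
    then have "Suc a < k" using k ab by simp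
    then have "energy a t \<le> 1" "energy (Suc a) t \<le> 1" using E by simp_all
    then show ?thesis using psi_sup[of a p t] by (smt (verit) zero_le_power2)
  qed
  \<comment> \<open>Here \<open>Suc b\<close> may equal \<open>k\<close>, whose energy is not
    assumed to be at most 1; it is however a summand of \<open>S\<close>.\<close>
  have B: "(psi b p t)\<^sup>2 \<le> 2 * S" for p
    using psi_sup[of b p t] ES[of b] ES[of "Suc b"] bc by simp
  have le: "\<bar>psi k p t * (psi a p t * psi b p t * psi c p t)\<bar>
      \<le> (1/2) * (psi k p t)\<^sup>2 + ((M\<^sup>2 + 2) * S) * (psi c p t)\<^sup>2" for p
  proof -
    have "\<bar>psi k p t * (psi a p t * psi b p t * psi c p t)\<bar>
        \<le> (1/2) * (psi k p t)\<^sup>2 + (1/2) * (psi a p t * psi b p t * psi c p t)\<^sup>2"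
      using sum_squares_bound[of "\<bar>psi k p t\<bar>" "\<bar>psi a p t * psi b p t * psi c p t\<bar>"]
      unfolding power2_abs abs_mult by (simp add: field_simps)
    also have "(psi a p t * psi b p t * psi c p t)\<^sup>2 = (psi a p t)\<^sup>2 * (psi b p t)\<^sup>2 * (psi c p t)\<^sup>2"
      by (simp add: power_mult_distrib)
    also have "\<dots> \<le> (M\<^sup>2 + 2) * (2 * S) * (psi c p t)\<^sup>2"
      by (intro mult_right_mono mult_mono A B) (simp_all add: S0)
    finally show ?thesis by (simp add: algebra_simps)
  qed
  have sm: "smooth2 (\<lambda>p t. r * (psi j p t)\<^sup>2)" for j r
    by (intro smooth2_mult smooth2_const smooth_psi_power)
  have "\<bar>arc_int (\<lambda>p t. psi k p t * (psi a p t * psi b p t * psi c p t)) t\<bar>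
      \<le> arc_int (\<lambda>p s. (1/2) * (psi k p s)\<^sup>2 + ((M\<^sup>2 + 2) * S) * (psi c p s)\<^sup>2) t"
    by (rule arc_int_abs_le) (intro smooth2_mult smooth2_add smooth_psi sm le)+
  also have "\<dots> = (1/2) * energy k t + ((M\<^sup>2 + 2) * S) * energy c t"
    unfolding energy_def by (simp only: arc_int_add[OF sm sm] arc_int_cmult)
  \<comment> \<open>Bounding \<open>energy c t\<close> by 1 keeps the estimate linear in
    \<open>S\<close>.\<close>
  also have "\<dots> \<le> (1/2) * S + ((M\<^sup>2 + 2) * S) * 1"
    by (intro add_mono mult_left_mono ES E bc) (simp_all add: S0)
  also have "\<dots> \<le> (M\<^sup>2 + 3) * S" using S0 by (simp add: algebra_simps)
  finally show ?thesis unfolding S_def .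
qed

lemma monomial_bound:
  assumes k: "a + b + c = k" and E: "\<And>j. j < k \<Longrightarrow> energy j t \<le> 1"
  shows "\<bar>arc_int (\<lambda>p t. psi k p t * (psi a p t * psi b p t * psi c p t)) t\<bar>
    \<le> (M\<^sup>2 + 3) * (\<Sum>i\<le>k. energy i t)"
proof -
  define S where "S = (\<Sum>i\<le>k. energy i t)"
  have S0: "0 \<le> S" unfolding S_def by (intro sum_nonneg energy_nonneg)
  \<comment> \<open>The extreme monomial puts all derivatives on one factor; the uniform bound on
    the curvature absorbs the other two.\<close>
  have top: "\<bar>arc_int (\<lambda>p t. psi k p t * (psi 0 p t * psi 0 p t * psi k p t)) t\<bar> \<le> (M\<^sup>2 + 3) * S"
  proof -
    have "\<bar>psi k p t * (psi 0 p t * psi 0 p t * psi k p t)\<bar> \<le> M\<^sup>2 * (psi k p t)\<^sup>2" for p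
    proof -
      have "(phi p t)\<^sup>2 \<le> M\<^sup>2" by (rule abs_le_square_iff[THEN iffD1]) (use phi_bound[of p t] in simp)
      then have "(phi p t)\<^sup>2 * (psi k p t)\<^sup>2 \<le> M\<^sup>2 * (psi k p t)\<^sup>2" by (rule mult_right_mono) simp
      moreover have "\<bar>psi k p t * (psi 0 p t * psi 0 p t * psi k p t)\<bar> = (phi p t)\<^sup>2 * (psi k p t)\<^sup>2"
        by (simp add: power2_eq_square abs_mult)
      ultimately show ?thesis by simp
    qed
    then have "\<bar>arc_int (\<lambda>p t. psi k p t * (psi 0 p t * psi 0 p t * psi k p t)) t\<bar>
        \<le> arc_int (\<lambda>p t. M\<^sup>2 * (psi k p t)\<^sup>2) t"
      by (intro arc_int_abs_le smooth2_mult smooth_psi smooth2_const smooth_psi_power)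
    also have "\<dots> = M\<^sup>2 * energy k t" unfolding energy_def by (rule arc_int_cmult)
    also have "\<dots> \<le> (M\<^sup>2 + 3) * S"
      using energy_le_sum[of k k t] S0 by (intro mult_mono) (simp_all add: S_def energy_nonneg)
    finally show ?thesis .
  qed
  show ?thesis
  proof (cases "a < k \<and> b < k \<and> c < k")
    case True
    then have lt: "a < k" "b < k" "c < k" by simp_all
    \<comment> \<open>The auxiliary bound wants a smallest index in first place; the other two cases
      permute the factors.\<close>
    consider "a \<le> b" "a \<le> c" | "b \<le> a" "b \<le> c" | "c \<le> a" "c \<le> b"
      by (cases "a \<le> b"; cases "b \<le> c"; cases "a \<le> c") simp_all
    then show ?thesis
    proof cases
      case 1
      from monomial_bound_aux[OF k 1 lt(2,3) E] show ?thesis .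
    next
      case 2
      have "b + a + c = k" using k by simp
      moreover have "(\<lambda>p t. psi k p t * (psi b p t * psi a p t * psi c p t)) =
          (\<lambda>p t. psi k p t * (psi a p t * psi b p t * psi c p t))"
        by (simp add: mult.commute)
      ultimately show ?thesis using monomial_bound_aux[OF _ 2 lt(1,3) E] by simp
    next
      case 3
      have "c + a + b = k" using k by simp
      moreover have "(\<lambda>p t. psi k p t * (psi c p t * psi a p t * psi b p t)) =
          (\<lambda>p t. psi k p t * (psi a p t * psi b p t * psi c p t))"
        by (intro ext) (simp add: mult_ac)
      ultimately show ?thesis using monomial_bound_aux[OF _ 3 lt(1,2) E] by simp
    qed
  next
    case False
    \<comment> \<open>An index equal to \<open>k\<close> uses up the whole weight, so the other two
      are 0. This includes \<open>k = 0\<close>, where all three coincide.\<close>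
    then have "a = k \<or> b = k \<or> c = k" using k by linarith
    then have "a = k \<and> b = 0 \<and> c = 0 \<or> a = 0 \<and> b = k \<and> c = 0 \<or> a = 0 \<and> b = 0 \<and> c = k"
      using k by (elim disjE) simp_all
    then have "(\<lambda>p t. psi k p t * (psi a p t * psi b p t * psi c p t)) =
          (\<lambda>p t. psi k p t * (psi 0 p t * psi 0 p t * psi k p t))"
      by (elim disjE conjE) (simp_all only: mult.commute mult.left_commute)
    then show ?thesis using top unfolding S_def by (simp only:)
  qed
qed

text \<open>Structural induction carries the monomial bound to all cubic forms. \<open>K\<close> is
  quantified before \<open>t\<close>, because the decay argument needs one constant for all
  times.\<close>

lemma cubic_bound:
  "cubic psi k f \<Longrightarrow> \<exists>K\<ge>0. \<forall>t. (\<forall>j<k. energy j t \<le> 1) \<longrightarrow>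
    \<bar>arc_int (\<lambda>p t. psi k p t * f p t) t\<bar> \<le> K * (\<Sum>i\<le>k. energy i t)"
proof (induction rule: cubic.induct)
  case (monomial a b c k)
  then show ?case
    by (intro exI[of _ "M\<^sup>2 + 3"]) (simp add: monomial_bound)
next
  case (add k f h)
  from add.IH obtain K L where K: "0 \<le> K" "\<And>t. (\<forall>j<k. energy j t \<le> 1) \<Longrightarrow>
    \<bar>arc_int (\<lambda>p t. psi k p t * f p t) t\<bar> \<le> K * (\<Sum>i\<le>k. energy i t)"
    and L: "0 \<le> L" "\<And>t. (\<forall>j<k. energy j t \<le> 1) \<Longrightarrow>
    \<bar>arc_int (\<lambda>p t. psi k p t * h p t) t\<bar> \<le> L * (\<Sum>i\<le>k. energy i t)" by blast
  have "arc_int (\<lambda>p t. psi k p t * (f p t + h p t)) t =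
      arc_int (\<lambda>p t. psi k p t * f p t) t + arc_int (\<lambda>p t. psi k p t * h p t) t" for t
    unfolding distrib_left by (intro arc_int_add smooth2_mult smooth_psi smooth_cubic[OF add.hyps(1)] smooth_cubic[OF add.hyps(2)])
  moreover have "\<bar>arc_int (\<lambda>p t. psi k p t * f p t) t + arc_int (\<lambda>p t. psi k p t * h p t) t\<bar>
      \<le> (K + L) * (\<Sum>i\<le>k. energy i t)" if "\<forall>j<k. energy j t \<le> 1" for t
    using K(2)[OF that] L(2)[OF that] unfolding distrib_right by linarith
  ultimately show ?case
    using K(1) L(1) by (intro exI[of _ "K + L"]) simp
next
  case (scale k f r)
  then obtain K where K: "0 \<le> K" "\<And>t. (\<forall>j<k. energy j t \<le> 1) \<Longrightarrow>
    \<bar>arc_int (\<lambda>p t. psi k p t * f p t) t\<bar> \<le> K * (\<Sum>i\<le>k. energy i t)" by blast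
  have "arc_int (\<lambda>p t. psi k p t * (r * f p t)) t = r * arc_int (\<lambda>p t. psi k p t * f p t) t" for t
    by (simp only: mult.left_commute arc_int_cmult)
  then show ?case
    using K by (intro exI[of _ "\<bar>r\<bar> * K"]) (simp add: abs_mult mult.assoc mult_left_mono)
qed

text \<open>The second order term, with coefficient 1/2 in the evolution of \<open>psi k\<close>, is
  doubled by the square and becomes \<open>- energy (Suc k) t\<close> through integration by parts.
  The rest is a multiple of \<open>energy k t\<close> or the integral of \<open>psi k\<close> times
  a cubic form.\<close>

lemma energy_evolution:
  "\<exists>K\<ge>0. \<forall>t. (\<forall>j<k. energy j t \<le> 1) \<longrightarrow> (\<exists>d. (energy k has_real_derivative d) (at t) \<and>
    d \<le> K * (\<Sum>i\<le>k. energy i t) - energy (Suc k) t)"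
proof -
  obtain R where R: "cubic psi k R"
    and dT_psi: "dT (psi k) = (\<lambda>p t. (1/2) * psi (Suc (Suc k)) p t + 2 * psi k p t + R p t)"
    using psi_evolution by blast
  \<comment> \<open>The change of the arc element contributes
    \<open>phi\<^sup>2 / 2 * (psi k)\<^sup>2\<close>, which is \<open>2 * psi k\<close> times the
    added summand; hence the factor 1/4.\<close>
  let ?R = "\<lambda>p t. R p t + (1/4) * (psi 0 p t * psi 0 p t * psi k p t)"
  have R': "cubic psi k ?R" by (intro cubic.add R cubic.scale cubic.monomial) simp
  note sm = smooth2_mult[OF smooth_psi[of k] smooth_cubic[OF R']]
  obtain K where K: "0 \<le> K" "\<And>t. (\<forall>j<k. energy j t \<le> 1) \<Longrightarrow>
      \<bar>arc_int (\<lambda>p t. psi k p t * ?R p t) t\<bar> \<le> K * (\<Sum>i\<le>k. energy i t)"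
    using cubic_bound[OF R'] by blast
  have deriv: "(energy k has_real_derivative
      - energy (Suc k) t + 4 * energy k t + 2 * arc_int (\<lambda>p t. psi k p t * ?R p t) t) (at t)" for t
  proof -
    have "((\<lambda>s. (psi k p s)\<^sup>2) has_real_derivative 2 * psi k p t * dT (psi k) p t) (at t)" for p t
      by (rule derivative_eq_intros smooth2_DERIV_T[OF smooth_psi] refl)+ simp
    then have dT_sq: "dT (\<lambda>p t. (psi k p t)\<^sup>2) p t + (phi p t)\<^sup>2 / 2 * (psi k p t)\<^sup>2 =
        (psi k p t * psi (Suc (Suc k)) p t + 4 * (psi k p t)\<^sup>2) + 2 * (psi k p t * ?R p t)" for p t
      by (simp add: dT_eqI dT_psi power2_eq_square algebra_simps)
    have "D (\<lambda>p t. psi k p t * psi (Suc k) p t) =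
        (\<lambda>p t. (psi (Suc k) p t)\<^sup>2 + psi k p t * psi (Suc (Suc k)) p t)"
      by (simp add: D_mult smooth_psi power2_eq_square)
    moreover have "periodic2 (\<lambda>p t. psi k p t * psi (Suc k) p t)"
      using periodic_psi unfolding periodic2_def by simp
    ultimately have "arc_int (\<lambda>p t. (psi (Suc k) p t)\<^sup>2 + psi k p t * psi (Suc (Suc k)) p t) t = 0"
      by (metis arc_int_D smooth2_mult smooth_psi)
    then have parts: "arc_int (\<lambda>p t. psi k p t * psi (Suc (Suc k)) p t) t = - energy (Suc k) t"
      unfolding energy_def
      by (simp add: arc_int_add smooth2_mult smooth_psi smooth_psi_power add_eq_0_iff)
    have sm1: "smooth2 (\<lambda>p t. psi k p t * psi (Suc (Suc k)) p t)"
      and sm2: "smooth2 (\<lambda>p t. 4 * (psi k p t)\<^sup>2)"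
      and sm3: "smooth2 (\<lambda>p t. 2 * (psi k p t * ?R p t))"
      by (intro smooth2_mult smooth2_const smooth_psi smooth_psi_power sm)+
    have "arc_int (\<lambda>p t. (psi k p t * psi (Suc (Suc k)) p t + 4 * (psi k p t)\<^sup>2) + 2 * (psi k p t * ?R p t)) t
        = - energy (Suc k) t + 4 * energy k t + 2 * arc_int (\<lambda>p t. psi k p t * ?R p t) t"
      by (simp only: arc_int_add[OF smooth2_add[OF sm1 sm2] sm3] arc_int_add[OF sm1 sm2]
          arc_int_cmult parts energy_def[of k])
    with DERIV_arc_int[OF smooth_psi_power[of k], of t] show ?thesis
      unfolding dT_sq energy_def[of k] by simp
  qed
  show ?thesis
  proof (rule exI[of _ "4 + 2 * K"], intro conjI allI impI)
    fix t assume "\<forall>j<k. energy j t \<le> 1"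
    from K(2)[OF this] have "2 * arc_int (\<lambda>p t. psi k p t * ?R p t) t \<le> 2 * (K * (\<Sum>i\<le>k. energy i t))"
      by linarith
    moreover have "4 * energy k t \<le> 4 * (\<Sum>i\<le>k. energy i t)" using energy_le_sum[of k k t] by simp
    moreover have "(4 + 2 * K) * (\<Sum>i\<le>k. energy i t) = 4 * (\<Sum>i\<le>k. energy i t) + 2 * (K * (\<Sum>i\<le>k. energy i t))"
      by (simp add: algebra_simps)
    ultimately have "- energy (Suc k) t + 4 * energy k t + 2 * arc_int (\<lambda>p t. psi k p t * ?R p t) t
        \<le> (4 + 2 * K) * (\<Sum>i\<le>k. energy i t) - energy (Suc k) t"
      by linarith
    then show "\<exists>d. (energy k has_real_derivative d) (at t) \<and>
        d \<le> (4 + 2 * K) * (\<Sum>i\<le>k. energy i t) - energy (Suc k) t"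
      using deriv by blast
  qed (use K in simp)
qed

text \<open>Twice the total length is a nonnegative antiderivative of the lowest energy.\<close>
lemma antideriv_energy_0: "antideriv_bdd_below (energy 0)"
proof -
  let ?L = "arc_int (\<lambda>p t. 1)"
  have "dT (\<lambda>p t. 1 :: real) = (\<lambda>p t. 0)" by (intro ext dT_eqI DERIV_const)
  then have eq: "arc_int (\<lambda>p t. dT (\<lambda>p t. 1) p t + (phi p t)\<^sup>2 / 2 * 1) t = (1/2) * energy 0 t" for t
    unfolding energy_def by (simp flip: arc_int_cmult)
  have "(?L has_real_derivative (1/2) * energy 0 t) (at t)" for t
    using DERIV_arc_int[OF smooth2_const, of 1 t] unfolding eq .
  then have "((\<lambda>t. 2 * ?L t) has_real_derivative energy 0 t) (at t)" for t
    using DERIV_cmult[of ?L "(1/2) * energy 0 t" t UNIV 2] by simp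
  moreover have "0 \<le> 2 * ?L t" for t
    unfolding arc_int_def using arc_integrable[OF smooth2_const, of 1 t]
    by (simp add: integral_nonneg less_imp_le[OF g_pos])
  ultimately show ?thesis unfolding antideriv_bdd_below_def by blast
qed

text \<open>The invariant is staggered: decay strictly below \<open>k\<close> makes the inequality
  for \<open>energy k\<close> applicable near minus infinity, and its dissipation term
  \<open>energy (Suc k)\<close> then becomes integrable.\<close>

lemma energy_past:
  "(\<forall>j<k. (energy j \<longlongrightarrow> 0) at_bot) \<and> (\<forall>j\<le>k. antideriv_bdd_below (energy j))"
proof (induction k)
  case 0
  then show ?case by (simp add: antideriv_energy_0)
next
  case (Suc k)
  let ?S = "\<lambda>t. \<Sum>i\<le>k. energy i t"
  have S: "antideriv_bdd_below ?S" using Suc by (intro antideriv_bdd_below_sum) blast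
  have "\<forall>\<^sub>F t in at_bot. \<forall>j\<in>{..<k}. energy j t < 1"
    using Suc by (intro eventually_ball_finite) (auto intro: order_tendstoD(2))
  then obtain T where T: "\<And>t j. t \<le> T \<Longrightarrow> j < k \<Longrightarrow> energy j t < 1"
    unfolding eventually_at_bot_linorder by auto
  obtain K where K: "0 \<le> K" "\<And>t. t \<le> T \<Longrightarrow> \<exists>d. (energy k has_real_derivative d) (at t) \<and>
    d \<le> K * ?S t - energy (Suc k) t"
    using energy_evolution[of k] T by (meson less_imp_le)
  have lim: "(energy k \<longlongrightarrow> 0) at_bot"
    by (rule past_decay[OF S energy_nonneg _ energy_nonneg K]) (simp_all add: energy_le_sum)
  have "antideriv_bdd_below (energy (Suc k))"
    by (rule past_gain[OF S lim energy_nonneg energy_continuous K])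
  then show ?case using lim Suc by (simp add: less_Suc_eq le_Suc_eq)
qed

theorem psi_tendsto_zero:
  assumes "0 < e"
  shows "\<exists>T. \<forall>t<T. \<forall>p. \<bar>psi k p t\<bar> < e"
proof -
  have "((\<lambda>t. energy k t + energy (Suc k) t) \<longlongrightarrow> 0 + 0) at_bot"
    \<comment> \<open>Decay is asserted strictly below the index, and \<open>energy (Suc k)\<close>
      is needed as well.\<close>
    using energy_past[of "Suc (Suc k)"] by (intro tendsto_add) auto
  then have "\<forall>\<^sub>F t in at_bot. energy k t + energy (Suc k) t < e\<^sup>2"
    using zero_less_power[OF assms] by (intro order_tendstoD(2)) simp_all
  then obtain T where T: "\<And>t. t \<le> T \<Longrightarrow> energy k t + energy (Suc k) t < e\<^sup>2"
    unfolding eventually_at_bot_linorder by blast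
  have "\<bar>psi k p t\<bar> < e" if "t < T" for p t
  proof -
    have "(psi k p t)\<^sup>2 < e\<^sup>2" using psi_sup[of k p t] T[of t] that by linarith
    then show ?thesis using assms power2_less_imp_less[of "\<bar>psi k p t\<bar>" e] by simp
  qed
  then show ?thesis by blast
qed

end

section \<open>Evolution of the centro-affine invariants\<close>

lemma periodic2_dT:
  assumes "periodic2 f"
  shows "periodic2 (dT f)"
proof -
  have "f (p + 2 * pi) = f p" for p using assms by (simp add: periodic2_def fun_eq_iff)
  then show ?thesis by (simp add: periodic2_def dT_def)
qed

text \<open>Extends identities from the interior of one period, where the flow can be differentiated
  in \<open>p\<close>: continuity adds the left endpoint, periodicity all other points.\<close>

lemma periodic2_eqI:
  assumes "smooth2 f" "smooth2 h" "periodic2 f" "periodic2 h"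
    and eq: "\<And>p. p \<in> {a<..<a + 2 * pi} \<Longrightarrow> f p t = h p t"
  shows "f p t = h p t"
proof -
  have "periodic2 (\<lambda>p t. f p t - h p t)" using assms(3,4) by (simp add: periodic2_def)
  then obtain q where q: "a \<le> q" "q < a + 2 * pi" "\<And>t. f q t - h q t = f p t - h p t"
    using periodic2_reduce[of "\<lambda>p t. f p t - h p t" a p] by metis
  have "closed {p. f p t = h p t}"
    using smooth2_continuous_P[of f UNIV t] smooth2_continuous_P[of h UNIV t] assms(1,2)
    by (intro closed_Collect_eq) auto
  then have "closure {a<..<a + 2 * pi} \<subseteq> {p. f p t = h p t}"
    using eq by (intro closure_minimal) auto
  moreover have "q \<in> closure {a<..<a + 2 * pi}" using q(1,2) by simp
  ultimately have "f q t = h q t" by blast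
  then show ?thesis using q(3)[of t] by simp
qed

lemma dP_eq_on_open:
  assumes "open S" "p \<in> S" "\<And>q. q \<in> S \<Longrightarrow> f q t = h q" "(h has_real_derivative d) (at p)"
  shows "dP f p t = d"
  using assms by (intro dP_eqI has_field_derivative_transform_within_open[OF assms(4,1,2)]) simp

text \<open>A positive second derivative at the critical point would make \<open>f'\<close> positive
  just to the right of \<open>z\<close>, and by the mean value theorem \<open>f\<close> would exceed
  its maximum.\<close>

lemma second_derivative_max_nonpos:
  fixes f :: "real \<Rightarrow> real"
  assumes f: "\<And>q. (f has_real_derivative f' q) (at q)" and f': "(f' has_real_derivative d) (at z)"
    and max: "\<And>q. f q \<le> f z"
  shows "f' z = 0" "d \<le> 0"
proof -
  show z: "f' z = 0"
    using DERIV_local_max[OF f[of z], of 1] max by simp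
  show "d \<le> 0"
  proof (rule ccontr)
    assume "\<not> d \<le> 0"
    then obtain e where e: "0 < e" "\<And>h. 0 < h \<Longrightarrow> h < e \<Longrightarrow> 0 < f' (z + h)"
      using DERIV_pos_inc_right[OF f'] z by auto
    obtain y where y: "z < y" "y < z + e / 2" "f (z + e / 2) - f z = (z + e / 2 - z) * f' y"
      using MVT2[of z "z + e / 2" f f'] f e(1) by auto
    have "0 < f' y" using e(2)[of "y - z"] y e(1) by simp
    then have "0 < (z + e / 2 - z) * f' y" using e(1) by simp
    then show False using y(3) max[of "z + e / 2"] by linarith
  qed
qed

text \<open>The factor of \<open>C\<close> in the flow is an integral from the base point
  \<open>p0\<close>, so the equation is imposed on one period starting there; its consequences are
  carried elsewhere by periodicity.\<close>

locale centro_affine_flow =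
  fixes C :: "real \<Rightarrow> real \<Rightarrow> real \<times> real" and lam p0 :: real
  assumes smooth: "smooth2 C"
    and periodic: "\<And>p t. C (p + 2 * pi) t = C p t"
    and star: "\<And>p t. det2 (C p t) (dP C p t) \<noteq> 0"
    and convex: "\<And>p t. det2 (dP C p t) (dP (dP C) p t) \<noteq> 0"
    and flow: "\<And>p t. p \<in> {p0..<p0 + 2 * pi} \<Longrightarrow>
        dT C p t = (lam + integral {p0..p} (\<lambda>q. ca_curv C q t * ca_metric C q t)) *\<^sub>R C p t
                   + (ca_curv C p t / 2) *\<^sub>R dXi C C p t"
begin

section \<open>Metric and curvature in coordinates\<close>

definition "x p t = fst (C p t)"
definition "y p t = snd (C p t)"
text \<open>\<open>u\<close> is [C, C_p] and \<open>w\<close> is [C_p, C_pp]; in coordinates all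
  later computations concern real products.\<close>

definition "u p t = x p t * dP y p t - y p t * dP x p t"
definition "w p t = dP x p t * dP (dP y) p t - dP y p t * dP (dP x) p t"

abbreviation "g \<equiv> ca_metric C"
abbreviation "phi \<equiv> ca_curv C"

lemma smooth_x: "smooth2 x" and smooth_y: "smooth2 y"
  using smooth2_bounded_linear(1)[OF bounded_linear_fst smooth]
    smooth2_bounded_linear(1)[OF bounded_linear_snd smooth] by (simp_all add: x_def[abs_def] y_def[abs_def])

lemma fst_derivs: "fst (dP C p t) = dP x p t" "fst (dT C p t) = dT x p t"
    "fst (dP (dP C) p t) = dP (dP x) p t"
  and snd_derivs: "snd (dP C p t) = dP y p t" "snd (dT C p t) = dT y p t"
    "snd (dP (dP C) p t) = dP (dP y) p t"
  unfolding x_def[abs_def] y_def[abs_def]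
  by (simp_all add: smooth2_bounded_linear[OF bounded_linear_fst] smooth2_bounded_linear[OF bounded_linear_snd]
      smooth smooth2_dP)

lemma periodic_xy: "periodic2 x" "periodic2 y"
  by (simp_all add: periodic2_def x_def y_def periodic)

lemma det2_u: "det2 (C p t) (dP C p t) = u p t"
  and det2_w: "det2 (dP C p t) (dP (dP C) p t) = w p t"
  by (simp_all add: det2_def u_def w_def fst_derivs snd_derivs flip: x_def y_def)

lemma u_nz: "u p t \<noteq> 0" and w_nz: "w p t \<noteq> 0"
  using star[of p t] convex[of p t] by (simp_all add: det2_u det2_w)

lemma smooth_u: "smooth2 u" and smooth_w: "smooth2 w"
  unfolding u_def[abs_def] w_def[abs_def]
  by (intro smooth2_diff smooth2_mult smooth2_dP smooth_x smooth_y)+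

lemma periodic_uw: "periodic2 u" "periodic2 w"
  using periodic_xy periodic2_dP[OF smooth_x] periodic2_dP[OF smooth_y]
    periodic2_dP[OF smooth2_dP[OF smooth_x]] periodic2_dP[OF smooth2_dP[OF smooth_y]]
  by (simp_all add: periodic2_def u_def w_def)

text \<open>The sign of \<open>w * u\<close> is constant along the curve, and at a point farthest from the origin it is
  read off from the second derivative of the squared distance.\<close>
lemma w_u_pos: "0 < w p t * u p t"
proof -
  let ?r = "\<lambda>q. x q t * x q t + y q t * y q t"
  let ?s = "\<lambda>q. 2 * (x q t * dP x q t + y q t * dP y q t)"
  have "continuous_on {0..2 * pi} ?r"
    by (intro continuous_on_add continuous_on_mult smooth2_continuous_P smooth_x smooth_y)
  then obtain z where z: "z \<in> {0..2 * pi}" "\<And>q. q \<in> {0..2 * pi} \<Longrightarrow> ?r q \<le> ?r z"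
    using continuous_attains_sup[of "{0..2 * pi}" ?r] by auto
  have per: "periodic2 (\<lambda>p t. x p t * x p t + y p t * y p t)"
    using periodic_xy by (simp add: periodic2_def)
  have max: "?r q \<le> ?r z" for q
  proof -
    obtain q' where q': "0 \<le> q'" "q' < 0 + 2 * pi"
      "\<And>s. x q' s * x q' s + y q' s * y q' s = x q s * x q s + y q s * y q s"
      using periodic2_reduce[OF per, of 0 q] by metis
    show ?thesis using z(2)[of q'] q' by simp
  qed
  have dr: "(?r has_real_derivative ?s q) (at q)" for q
    by (rule derivative_eq_intros smooth2_DERIV_P[OF smooth_x] smooth2_DERIV_P[OF smooth_y] refl)+
      (simp add: algebra_simps)
  have ds: "(?s has_real_derivative 2 * (dP x z t * dP x z t + x z t * dP (dP x) z t
      + (dP y z t * dP y z t + y z t * dP (dP y) z t))) (at z)"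
    by (rule derivative_eq_intros smooth2_DERIV_P[OF smooth_x] smooth2_DERIV_P[OF smooth_y]
        smooth2_DERIV_P[OF smooth2_dP[OF smooth_x]] smooth2_DERIV_P[OF smooth2_dP[OF smooth_y]] refl)+
      (simp add: algebra_simps)
  define n where "n = x z t * dP (dP x) z t + y z t * dP (dP y) z t"
  have s0: "x z t * dP x z t + y z t * dP y z t = 0"
    using second_derivative_max_nonpos(1)[OF dr ds max] by simp
  have "dP x z t * dP x z t + x z t * dP (dP x) z t + (dP y z t * dP y z t + y z t * dP (dP y) z t) \<le> 0"
    using second_derivative_max_nonpos(2)[OF dr ds max] by simp
  then have n_le: "n \<le> - (dP x z t * dP x z t + dP y z t * dP y z t)" unfolding n_def by linarith
  have "dP x z t * dP x z t + dP y z t * dP y z t > 0"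
    using u_nz[of z t] by (auto simp: u_def sum_squares_gt_zero_iff)
  then have "n < 0" using n_le by linarith
  \<comment> \<open>The plane identity |C|^2 [C_p, C_pp] = <C, C_p> [C, C_pp] - [C, C_p] <C, C_pp>;
    its first term vanishes at the farthest point.\<close>
  have "w z t * ?r z = (x z t * dP x z t + y z t * dP y z t) * (x z t * dP (dP y) z t - y z t * dP (dP x) z t)
      - u z t * n"
    unfolding w_def u_def n_def by (simp add: algebra_simps)
  then have "w z t * ?r z = - (u z t * n)" unfolding s0 by simp
  then have "u z t * (w z t * ?r z) = - n * (u z t * u z t)" by (simp only:) simp
  then have "w z t * u z t * ?r z = - n * (u z t * u z t)" by (simp only: mult_ac)
  moreover have "0 < - n * (u z t * u z t)"
  proof (rule mult_pos_pos)
    show "0 < u z t * u z t" using u_nz[of z t] not_real_square_gt_zero[of "u z t"] by blast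
  qed (use \<open>n < 0\<close> in simp)
  ultimately have "0 < w z t * u z t * ?r z" by simp
  moreover have "0 \<le> ?r z" by simp
  ultimately have pos: "0 < w z t * u z t" by (metis mult_nonpos_nonneg not_less)
  have conn: "connected ((\<lambda>q. w q t * u q t) ` UNIV)"
    by (intro connected_continuous_image continuous_on_mult smooth2_continuous_P smooth_w smooth_u connected_UNIV)
  show ?thesis
  proof (rule ccontr)
    assume "\<not> 0 < w p t * u p t"
    then have "0 \<in> (\<lambda>q. w q t * u q t) ` UNIV"
      using connectedD_interval[OF conn, of "w p t * u p t" "w z t * u z t" 0] pos by auto
    then show False using u_nz w_nz by auto
  qed
qed

lemma g_eq: "g p t = sqrt (w p t / u p t)"
  by (simp add: ca_metric_def det2_u det2_w)

lemma ratio_pos: "0 < w p t / u p t"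
  using w_u_pos[of p t] by (auto simp: zero_less_mult_iff zero_less_divide_iff)

lemma g_pos: "0 < g p t" unfolding g_eq using ratio_pos by simp

lemma g_nz [simp]: "g p t \<noteq> 0" using g_pos[of p t] by simp

lemma smooth_g: "smooth2 g"
proof -
  have "smooth2 (\<lambda>p t. sqrt (w p t / u p t))"
    by (intro smooth2_sqrt smooth2_divide smooth_w smooth_u u_nz ratio_pos)
  then show ?thesis by (simp flip: g_eq)
qed

lemma periodic_g: "periodic2 g"
  using periodic_uw by (simp add: periodic2_def g_eq)

text \<open>Free of the square root, this is the form in which the metric is differentiated
  later.\<close>

lemma g_sq_u: "(g p t)\<^sup>2 * u p t = w p t"
  unfolding g_eq using ratio_pos[of p t] u_nz[of p t] by (simp add: less_imp_le)

lemma dP_u: "dP u p t = x p t * dP (dP y) p t - y p t * dP (dP x) p t"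
proof (rule dP_eqI)
  show "((\<lambda>q. u q t) has_real_derivative x p t * dP (dP y) p t - y p t * dP (dP x) p t) (at p)"
    unfolding u_def
    by (rule derivative_eq_intros smooth2_DERIV_P[OF smooth_x] smooth2_DERIV_P[OF smooth_y]
        smooth2_DERIV_P[OF smooth2_dP[OF smooth_x]] smooth2_DERIV_P[OF smooth2_dP[OF smooth_y]] refl)+
      (simp add: algebra_simps)
qed

text \<open>Expanding the second arc-length derivative of \<open>C\<close> and using [C, C_pp] =
  \<open>dP u\<close> exhibits the curvature as the arc-length derivative of ln (|u| / g).\<close>

lemma phi_eq: "phi p t = dP u p t / (g p t * u p t) - dP g p t / (g p t)\<^sup>2"
proof -
  have "((\<lambda>q. (1 / g q t) *\<^sub>R dP C q t) has_vector_derivative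
      (1 / g p t) *\<^sub>R dP (dP C) p t + (- dP g p t / (g p t)\<^sup>2) *\<^sub>R dP C p t) (at p)"
  proof (rule has_vector_derivative_scaleR)
    show "((\<lambda>q. 1 / g q t) has_real_derivative - dP g p t / (g p t)\<^sup>2) (at p)"
      by (rule derivative_eq_intros smooth2_DERIV_P[OF smooth_g] refl)+ (simp_all add: power2_eq_square)
    show "((\<lambda>q. dP C q t) has_vector_derivative dP (dP C) p t) (at p)"
      by (rule smooth2_has_vector_derivative_P[OF smooth2_dP[OF smooth]])
  qed
  then have dd: "dP (dXi C C) p t =
      (1 / g p t) *\<^sub>R dP (dP C) p t + (- dP g p t / (g p t)\<^sup>2) *\<^sub>R dP C p t"
    unfolding dXi_def by (intro dP_vector_eqI)
  have d1: "det2 (dXi C C p t) (C p t) = - u p t / g p t"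
    unfolding dXi_def det2_def u_def by (simp add: fst_derivs snd_derivs flip: x_def y_def) (simp add: field_simps)
  have d2: "det2 (dXi C (dXi C C) p t) (C p t) =
      (1 / g p t) * (- dP u p t / g p t + dP g p t / (g p t)\<^sup>2 * u p t)"
    unfolding dXi_def[of C "dXi C C"] dd det2_def dP_u u_def
    by (simp add: fst_derivs snd_derivs flip: x_def y_def) (simp add: field_simps)
  show ?thesis
    unfolding ca_curv_def d1 d2 using u_nz[of p t] by (simp add: field_simps power2_eq_square)
qed

lemma smooth_phi: "smooth2 phi"
proof -
  have "smooth2 (\<lambda>p t. dP u p t / (g p t * u p t) - dP g p t / (g p t)\<^sup>2)"
    using u_nz by (intro smooth2_intros smooth_u smooth_g) simp_all
  then show ?thesis by (simp flip: phi_eq)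
qed

lemma periodic_phi: "periodic2 phi"
  using periodic_uw periodic_g periodic2_dP[OF smooth_u] periodic2_dP[OF smooth_g]
  by (simp add: periodic2_def phi_eq)

text \<open>In these terms the flow reads C_t = W C + V C_p; \<open>a\<close> is the curvature as a
  density in \<open>p\<close>, hence the \<open>p\<close>-derivative of \<open>W\<close> inside the
  period.\<close>

definition "a p t = phi p t * g p t"
definition "V p t = phi p t / (2 * g p t)"
definition "W p t = lam + integral {p0..p} (\<lambda>q. a q t)"

lemma smooth_a: "smooth2 a"
  unfolding a_def[abs_def] by (intro smooth2_mult smooth_phi smooth_g)

lemma smooth_V: "smooth2 V"
  unfolding V_def[abs_def] by (intro smooth2_intros smooth_phi smooth_g) simp

lemma a_eq: "a p t = dP u p t / u p t - dP g p t / g p t"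
  using u_nz[of p t] unfolding a_def phi_eq by (simp add: field_simps power2_eq_square)

lemma a_u_g: "a p t * u p t * g p t = dP u p t * g p t - dP g p t * u p t"
  using u_nz[of p t] unfolding a_eq by (simp add: field_simps)

text \<open>By \<open>a_u_g\<close> the zeros of the curvature are the critical points of the
  periodic quotient \<open>u / g\<close>, and Rolle's theorem provides one.\<close>

lemma phi_zero: "\<exists>z. phi z t = 0"
proof -
  let ?v = "\<lambda>p t. u p t / g p t"
  have v: "smooth2 ?v" by (intro smooth2_divide smooth_u smooth_g) simp
  have "?v 0 t = ?v (2 * pi) t"
    using periodic_uw(1) periodic_g unfolding periodic2_def by (metis add_0)
  moreover have "(\<lambda>q. ?v q t) differentiable at z" for z
    using smooth2_DERIV_P[OF v] unfolding real_differentiable_def by blast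
  ultimately obtain z where z: "DERIV (\<lambda>q. ?v q t) z :> 0"
    using Rolle[of 0 "2 * pi" "\<lambda>q. ?v q t"] smooth2_continuous_P[OF v] by auto
  have "((\<lambda>q. ?v q t) has_real_derivative (dP u z t * g z t - u z t * dP g z t) / (g z t * g z t)) (at z)"
    by (intro DERIV_divide smooth2_DERIV_P smooth_u smooth_g) simp
  then have "dP u z t * g z t - u z t * dP g z t = 0"
    using DERIV_unique[OF z] by fastforce
  then have "a z t * u z t * g z t = 0" using a_u_g[of z t] by (simp add: mult.commute)
  then show ?thesis using u_nz by (auto simp: a_def)
qed

section \<open>Evolution equations in the interior of one period\<close>

context
  fixes t :: real
begin

abbreviation (input) "S \<equiv> {p0<..<p0 + 2 * pi}"

lemma DERIV_W: "p \<in> S \<Longrightarrow> ((\<lambda>q. W q t) has_real_derivative a p t) (at p)"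
proof -
  assume p: "p \<in> S"
  have "((\<lambda>q. integral {p0..q} (\<lambda>q. a q t)) has_real_derivative a p t) (at p within {p0..p0 + 2 * pi})"
    using p by (intro integral_has_real_derivative smooth2_continuous_P smooth_a) simp
  moreover have "at p within {p0..p0 + 2 * pi} = at p"
    using p by (intro at_within_interior) simp
  ultimately have "((\<lambda>q. lam + integral {p0..q} (\<lambda>q. a q t)) has_real_derivative 0 + a p t) (at p)"
    by (intro DERIV_add DERIV_const) simp
  then show ?thesis by (simp add: W_def)
qed

lemma flow_xy:
  assumes "p \<in> S"
  shows "dT x p t = W p t * x p t + V p t * dP x p t" "dT y p t = W p t * y p t + V p t * dP y p t"
proof -
  have "dT C p t = W p t *\<^sub>R C p t + (phi p t / 2) *\<^sub>R ((1 / g p t) *\<^sub>R dP C p t)"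
    using flow[of p t] assms by (simp add: W_def a_def dXi_def)
  then have "fst (dT C p t) = fst (W p t *\<^sub>R C p t + (phi p t / 2) *\<^sub>R ((1 / g p t) *\<^sub>R dP C p t))"
    "snd (dT C p t) = snd (W p t *\<^sub>R C p t + (phi p t / 2) *\<^sub>R ((1 / g p t) *\<^sub>R dP C p t))"
    by simp_all
  then show "dT x p t = W p t * x p t + V p t * dP x p t" "dT y p t = W p t * y p t + V p t * dP y p t"
    by (simp_all add: fst_derivs snd_derivs V_def flip: x_def y_def)
qed

text \<open>Both coordinates solve the same linear equation, so a generic \<open>z\<close> serves
  for both. The equation is assumed on all of \<open>S\<close> because, after swapping mixed
  partials, it is differentiated in \<open>p\<close>.\<close>

lemma flow_derivs:
  assumes z: "smooth2 z" and zt: "\<forall>p\<in>S. dT z p t = W p t * z p t + V p t * dP z p t"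
    and p: "p \<in> S"
  shows "dT (dP z) p t = a p t * z p t + W p t * dP z p t + dP V p t * dP z p t + V p t * dP (dP z) p t"
    and "dT (dP (dP z)) p t = dP a p t * z p t + 2 * (a p t * dP z p t) + W p t * dP (dP z) p t
      + dP (dP V) p t * dP z p t + 2 * (dP V p t * dP (dP z) p t) + V p t * dP (dP (dP z)) p t"
proof -
  note d = DERIV_W smooth2_DERIV_P[OF z] smooth2_DERIV_P[OF smooth2_dP[OF z]]
    smooth2_DERIV_P[OF smooth2_dP[OF smooth2_dP[OF z]]] smooth2_DERIV_P[OF smooth_a]
    smooth2_DERIV_P[OF smooth_V] smooth2_DERIV_P[OF smooth2_dP[OF smooth_V]]
  have 1: "dT (dP z) p t = a p t * z p t + W p t * dP z p t + dP V p t * dP z p t + V p t * dP (dP z) p t"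
    if "p \<in> S" for p
    unfolding dP_dT_commute[OF z, symmetric]
  proof (rule dP_eq_on_open[where S = "{p0<..<p0 + 2 * pi}"])
    show "dT z q t = W q t * z q t + V q t * dP z q t" if "q \<in> S" for q
      by (rule bspec[OF zt that])
    show "((\<lambda>q. W q t * z q t + V q t * dP z q t) has_real_derivative
      a p t * z p t + W p t * dP z p t + dP V p t * dP z p t + V p t * dP (dP z) p t) (at p)"
      by (rule derivative_eq_intros d that refl)+ (simp add: algebra_simps)
  qed (use that in simp_all)
  then show "dT (dP z) p t = a p t * z p t + W p t * dP z p t + dP V p t * dP z p t + V p t * dP (dP z) p t"
    using p .
  show "dT (dP (dP z)) p t = dP a p t * z p t + 2 * (a p t * dP z p t) + W p t * dP (dP z) p t
      + dP (dP V) p t * dP z p t + 2 * (dP V p t * dP (dP z) p t) + V p t * dP (dP (dP z)) p t"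
    unfolding dP_dT_commute[OF smooth2_dP[OF z], symmetric]
  proof (rule dP_eq_on_open[where S = "{p0<..<p0 + 2 * pi}"])
    show "dT (dP z) q t = a q t * z q t + W q t * dP z q t + dP V q t * dP z q t + V q t * dP (dP z) q t"
      if "q \<in> S" for q by (rule 1[OF that])
    show "((\<lambda>q. a q t * z q t + W q t * dP z q t + dP V q t * dP z q t + V q t * dP (dP z) q t)
      has_real_derivative dP a p t * z p t + 2 * (a p t * dP z p t) + W p t * dP (dP z) p t
      + dP (dP V) p t * dP z p t + 2 * (dP V p t * dP (dP z) p t) + V p t * dP (dP (dP z)) p t) (at p)"
      by (rule derivative_eq_intros d p refl)+ (simp add: algebra_simps)
  qed (use p in simp_all)
qed

lemma flow_x: "\<forall>p\<in>S. dT x p t = W p t * x p t + V p t * dP x p t"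
  and flow_y: "\<forall>p\<in>S. dT y p t = W p t * y p t + V p t * dP y p t"
  by (simp_all add: flow_xy)

lemmas flow_derivs_x = flow_derivs[OF smooth_x flow_x]
lemmas flow_derivs_y = flow_derivs[OF smooth_y flow_y]

text \<open>The summand a C of C_pt is parallel to \<open>C\<close> and drops out of
  [C, C_pt].\<close>

lemma dT_u:
  assumes p: "p \<in> S"
  shows "dT u p t = (2 * W p t + dP V p t) * u p t + V p t * dP u p t"
proof (rule dT_eqI)
  show "((\<lambda>s. u p s) has_real_derivative (2 * W p t + dP V p t) * u p t + V p t * dP u p t) (at t)"
    unfolding dP_u unfolding u_def
    by (rule derivative_eq_intros smooth2_DERIV_T[OF smooth_x] smooth2_DERIV_T[OF smooth_y]
        smooth2_DERIV_T[OF smooth2_dP[OF smooth_x]] smooth2_DERIV_T[OF smooth2_dP[OF smooth_y]] refl)+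
      (simp add: flow_xy[OF p] flow_derivs_x[OF p] flow_derivs_y[OF p] dP_u algebra_simps)
qed

lemma dP_w: "dP w p t = dP x p t * dP (dP (dP y)) p t - dP y p t * dP (dP (dP x)) p t"
proof (rule dP_eqI)
  show "((\<lambda>q. w q t) has_real_derivative
      dP x p t * dP (dP (dP y)) p t - dP y p t * dP (dP (dP x)) p t) (at p)"
    unfolding w_def
    by (rule derivative_eq_intros smooth2_DERIV_P[OF smooth2_dP[OF smooth_x]]
        smooth2_DERIV_P[OF smooth2_dP[OF smooth_y]] smooth2_DERIV_P[OF smooth2_dP[OF smooth2_dP[OF smooth_x]]]
        smooth2_DERIV_P[OF smooth2_dP[OF smooth2_dP[OF smooth_y]]] refl)+
      (simp add: algebra_simps)
qed

text \<open>In [C_pt, C_pp] + [C_p, C_ppt] the multiples of C_p in C_ppt drop out, among them the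
  second derivative of \<open>V\<close>; the multiples of \<open>C\<close> produce the terms in
  \<open>a\<close> and \<open>dP a\<close>.\<close>

lemma dT_w:
  assumes p: "p \<in> S"
  shows "dT w p t = a p t * dP u p t - dP a p t * u p t + (2 * W p t + 3 * dP V p t) * w p t + V p t * dP w p t"
proof (rule dT_eqI)
  show "((\<lambda>s. w p s) has_real_derivative
      a p t * dP u p t - dP a p t * u p t + (2 * W p t + 3 * dP V p t) * w p t + V p t * dP w p t) (at t)"
    unfolding dP_u dP_w unfolding u_def w_def
    by (rule derivative_eq_intros smooth2_DERIV_T[OF smooth2_dP[OF smooth_x]]
        smooth2_DERIV_T[OF smooth2_dP[OF smooth_y]] smooth2_DERIV_T[OF smooth2_dP[OF smooth2_dP[OF smooth_x]]]
        smooth2_DERIV_T[OF smooth2_dP[OF smooth2_dP[OF smooth_y]]] refl)+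
      (simp add: flow_derivs_x[OF p] flow_derivs_y[OF p] algebra_simps)
qed

text \<open>\<open>g_sq_u\<close> is differentiated in \<open>t\<close>. The terms in
  \<open>W\<close> cancel, and the derivatives of \<open>phi\<close> coming from \<open>V\<close>
  and from \<open>a\<close> cancel each other; \<open>a_u_g\<close> evaluates what remains.\<close>

lemma dT_g_interior:
  assumes p: "p \<in> S"
  shows "dT g p t = (phi p t)\<^sup>2 / 2 * g p t"
proof -
  have dt: "((\<lambda>s. (g p s)\<^sup>2 * u p s) has_real_derivative 2 * g p t * dT g p t * u p t + (g p t)\<^sup>2 * dT u p t) (at t)"
    by (rule derivative_eq_intros smooth2_DERIV_T[OF smooth_g] smooth2_DERIV_T[OF smooth_u] refl)+ simp
  have gt: "2 * g p t * dT g p t * u p t + (g p t)\<^sup>2 * dT u p t = dT w p t"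
    by (rule dT_eqI[of w, OF dt[unfolded g_sq_u], symmetric])
  have dp: "((\<lambda>q. (g q t)\<^sup>2 * u q t) has_real_derivative 2 * g p t * dP g p t * u p t + (g p t)\<^sup>2 * dP u p t) (at p)"
    by (rule derivative_eq_intros smooth2_DERIV_P[OF smooth_g] smooth2_DERIV_P[OF smooth_u] refl)+ simp
  have gp: "dP w p t = 2 * g p t * dP g p t * u p t + (g p t)\<^sup>2 * dP u p t"
    by (rule dP_eqI[of w, OF dp[unfolded g_sq_u]])
  have ap: "dP a p t = dP phi p t * g p t + phi p t * dP g p t"
    unfolding a_def[abs_def] by (simp add: dP_mult smooth_phi smooth_g)
  have phi: "(\<lambda>p t. 2 * (V p t * g p t)) = phi" by (simp add: V_def fun_eq_iff)
  have "dP (\<lambda>p t. 2 * (V p t * g p t)) p t = 2 * (dP V p t * g p t + V p t * dP g p t)"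
    by (simp only: dP_cmult[OF smooth2_mult[OF smooth_V smooth_g]] dP_mult[OF smooth_V smooth_g])
  then have "dP phi p t = 2 * (dP V p t * g p t + V p t * dP g p t)" unfolding phi .
  then have Vp: "g p t * dP phi p t = 2 * dP V p t * (g p t)\<^sup>2 + 2 * V p t * g p t * dP g p t"
    by (simp add: power2_eq_square algebra_simps)
  have "2 * g p t * dT g p t * u p t = dT w p t - (g p t)\<^sup>2 * dT u p t" using gt by linarith
  also have "\<dots> = a p t * dP u p t - dP a p t * u p t
      + (2 * dP V p t * (g p t)\<^sup>2 + 2 * V p t * g p t * dP g p t) * u p t"
    unfolding dT_w[OF p] dT_u[OF p] gp g_sq_u[of p t, symmetric] by (simp add: algebra_simps)
  also have "\<dots> = phi p t * (dP u p t * g p t - dP g p t * u p t)"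
    unfolding Vp[symmetric] ap unfolding a_def by (simp add: algebra_simps)
  also have "\<dots> = 2 * g p t * ((phi p t)\<^sup>2 / 2 * g p t) * u p t"
    unfolding a_u_g[symmetric] a_def by (simp add: power2_eq_square)
  finally show ?thesis using u_nz[of p t] by simp
qed

text \<open>The logarithmic time derivative of \<open>[C, C\<^sub>p]\<close>, in a form whose \<open>p\<close>-derivative needs no second
  derivative of \<open>V\<close>.\<close>
lemma dT_u':
  assumes p: "p \<in> S"
  shows "dT u p t = (2 * W p t + (1/2) * arc_deriv g phi p t + (1/2) * (phi p t * phi p t)) * u p t"
proof -
  have "((\<lambda>q. V q t) has_real_derivative
      (dP phi p t * (2 * g p t) - phi p t * (2 * dP g p t)) / ((2 * g p t) * (2 * g p t))) (at p)"
    unfolding V_def by (intro DERIV_divide DERIV_cmult smooth2_DERIV_P smooth_phi smooth_g) simp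
  then have Vp: "dP V p t = (dP phi p t * g p t - phi p t * dP g p t) / (2 * (g p t)\<^sup>2)"
    by (subst dP_eqI) (auto simp: field_simps power2_eq_square)
  have up: "dP u p t = (phi p t * g p t + dP g p t / g p t) * u p t"
    using a_eq[of p t] u_nz[of p t] unfolding a_def by (simp add: field_simps)
  show ?thesis
    unfolding dT_u[OF p] Vp up V_def arc_deriv_def by (simp add: field_simps power2_eq_square)
qed

text \<open>The time derivative of \<open>a\<close> is computed twice: from \<open>phi * g\<close>,
  and by \<open>a_eq\<close> from the \<open>p\<close>-derivative of ln |u| - ln g. In the latter,
  the contribution of ln g cancels that of the square term in \<open>dT_u'\<close>, leaving
  \<open>2 * a\<close> and half the \<open>p\<close>-derivative of the first arc-length derivative
  of \<open>phi\<close>. The cubic term comes from \<open>dT_g_interior\<close>.\<close>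

lemma dT_phi_interior:
  assumes p: "p \<in> S"
  shows "dT phi p t = arc_deriv g (arc_deriv g phi) p t / 2 + 2 * phi p t - phi p t ^ 3 / 2"
proof -
  let ?c = "arc_deriv g phi"
  have c: "smooth2 ?c" unfolding arc_deriv_def by (intro smooth2_divide smooth2_dP smooth_phi smooth_g) simp
  let ?h = "2 * W p t + (1/2) * ?c p t + (1/2) * (phi p t * phi p t)"
  have upt: "dT (dP u) p t = (2 * a p t + (1/2) * dP ?c p t + phi p t * dP phi p t) * u p t + ?h * dP u p t"
    unfolding dP_dT_commute[OF smooth_u, symmetric]
  proof (rule dP_eq_on_open[where S = "{p0<..<p0 + 2 * pi}"])
    show "dT u q t = (2 * W q t + (1/2) * ?c q t + (1/2) * (phi q t * phi q t)) * u q t"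
      if "q \<in> S" for q by (rule dT_u'[OF that])
    show "((\<lambda>q. (2 * W q t + (1/2) * ?c q t + (1/2) * (phi q t * phi q t)) * u q t) has_real_derivative
      (2 * a p t + (1/2) * dP ?c p t + phi p t * dP phi p t) * u p t + ?h * dP u p t) (at p)"
      by (rule derivative_eq_intros DERIV_W p smooth2_DERIV_P[OF c] smooth2_DERIV_P[OF smooth_phi]
          smooth2_DERIV_P[OF smooth_u] refl)+ (simp add: algebra_simps)
  qed (use p in simp_all)
  have gpt: "dT (dP g) p t = phi p t * dP phi p t * g p t + (phi p t)\<^sup>2 / 2 * dP g p t"
    unfolding dP_dT_commute[OF smooth_g, symmetric]
  proof (rule dP_eq_on_open[where S = "{p0<..<p0 + 2 * pi}"])
    show "dT g q t = (1/2) * (phi q t * phi q t) * g q t" if "q \<in> S" for q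
      by (simp add: dT_g_interior[OF that] power2_eq_square)
    show "((\<lambda>q. (1/2) * (phi q t * phi q t) * g q t) has_real_derivative
      phi p t * dP phi p t * g p t + (phi p t)\<^sup>2 / 2 * dP g p t) (at p)"
      by (rule derivative_eq_intros smooth2_DERIV_P[OF smooth_phi] smooth2_DERIV_P[OF smooth_g] refl)+
        (simp add: power2_eq_square algebra_simps)
  qed (use p in simp_all)
  have "((\<lambda>s. dP u p s / u p s - dP g p s / g p s) has_real_derivative
      (dT (dP u) p t * u p t - dP u p t * dT u p t) / (u p t * u p t)
      - (dT (dP g) p t * g p t - dP g p t * dT g p t) / (g p t * g p t)) (at t)"
    using u_nz[of p t]
    by (intro DERIV_diff DERIV_divide smooth2_DERIV_T smooth2_dP smooth_u smooth_g) simp_all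
  moreover have "dT (dP u) p t * u p t - dP u p t * dT u p t
      = (2 * a p t + (1/2) * dP ?c p t + phi p t * dP phi p t) * (u p t * u p t)"
    unfolding upt dT_u'[OF p] by (simp add: algebra_simps)
  moreover have "dT (dP g) p t * g p t - dP g p t * dT g p t = phi p t * dP phi p t * (g p t * g p t)"
    unfolding gpt dT_g_interior[OF p] by (simp add: algebra_simps)
  ultimately have "((\<lambda>s. a p s) has_real_derivative 2 * a p t + (1/2) * dP ?c p t) (at t)"
    using u_nz[of p t] unfolding a_eq by simp
  moreover have "((\<lambda>s. a p s) has_real_derivative dT phi p t * g p t + dT g p t * phi p t) (at t)"
    unfolding a_def by (intro DERIV_mult smooth2_DERIV_T smooth_phi smooth_g)
  ultimately have "dT phi p t * g p t + dT g p t * phi p t = 2 * a p t + (1/2) * dP ?c p t"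
    by (rule DERIV_unique[rotated])
  then show ?thesis
    unfolding dT_g_interior[OF p] a_def arc_deriv_def[of g ?c]
    by (simp add: field_simps power2_eq_square power3_eq_cube)
qed

end

section \<open>Evolution on the whole curve and the convergence theorem\<close>

lemma dT_g: "dT g p t = (phi p t)\<^sup>2 / 2 * g p t"
proof (rule periodic2_eqI[where a=p0 and f="dT g" and h="\<lambda>p t. (phi p t)\<^sup>2 / 2 * g p t"])
  show "smooth2 (\<lambda>p t. (phi p t)\<^sup>2 / 2 * g p t)"
    by (intro smooth2_mult smooth2_divide smooth2_power smooth2_const smooth_phi smooth_g) simp
  show "periodic2 (\<lambda>p t. (phi p t)\<^sup>2 / 2 * g p t)"
    using periodic_phi periodic_g by (simp add: periodic2_def)
qed (simp_all add: smooth2_dT smooth_g periodic2_dT periodic_g dT_g_interior)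

lemma dT_phi: "dT phi p t = arc_deriv g (arc_deriv g phi) p t / 2 + 2 * phi p t - phi p t ^ 3 / 2"
proof (rule periodic2_eqI[where a=p0 and f="dT phi"
      and h="\<lambda>p t. arc_deriv g (arc_deriv g phi) p t / 2 + 2 * phi p t - phi p t ^ 3 / 2"])
  have c: "smooth2 (arc_deriv g phi)"
    unfolding arc_deriv_def by (intro smooth2_divide smooth2_dP smooth_phi smooth_g) simp
  have cc: "smooth2 (arc_deriv g (arc_deriv g phi))"
    unfolding arc_deriv_def[of g "arc_deriv g phi"]
    by (intro smooth2_divide smooth2_dP c smooth_g) simp
  have "periodic2 (arc_deriv g phi)"
    using periodic_g periodic2_dP[OF smooth_phi periodic_phi] by (simp add: periodic2_def arc_deriv_def)
  then have pcc: "periodic2 (arc_deriv g (arc_deriv g phi))"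
    using periodic_g periodic2_dP[OF c] by (simp add: periodic2_def arc_deriv_def[of g "arc_deriv g phi"])
  show "smooth2 (\<lambda>p t. arc_deriv g (arc_deriv g phi) p t / 2 + 2 * phi p t - phi p t ^ 3 / 2)"
    by (intro smooth2_add smooth2_mult smooth2_diff smooth2_divide smooth2_power smooth2_const smooth_phi cc)
      simp_all
  show "periodic2 (\<lambda>p t. arc_deriv g (arc_deriv g phi) p t / 2 + 2 * phi p t - phi p t ^ 3 / 2)"
    using periodic_phi pcc by (simp add: periodic2_def)
qed (simp_all add: smooth2_dT smooth_phi periodic2_dT periodic_phi dT_phi_interior)

lemma dXi_eq_arc_deriv: "dXi C = arc_deriv g"
  by (intro ext) (simp add: dXi_def arc_deriv_def)

end

theorem theorem1p2:
  fixes C :: "real \<Rightarrow> real \<Rightarrow> real \<times> real" and lam p0 :: real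
  assumes smooth: "smooth2 C"
    and periodic: "\<And>p t. C (p + 2 * pi) t = C p t"
    and embedded: "\<And>t. inj_on (\<lambda>p. C p t) {0..<2 * pi}"
    and star: "\<And>p t. det2 (C p t) (dP C p t) \<noteq> 0"
    and convex: "\<And>p t. det2 (dP C p t) (dP (dP C) p t) \<noteq> 0"
    and flow: "\<And>p t. p \<in> {p0..<p0 + 2 * pi} \<Longrightarrow>
        dT C p t = (lam + integral {p0..p} (\<lambda>q. ca_curv C q t * ca_metric C q t)) *\<^sub>R C p t
                   + (ca_curv C p t / 2) *\<^sub>R dXi C C p t"
    and bounded: "\<exists>M. \<forall>p t. \<bar>ca_curv C p t\<bar> \<le> M"
  shows "\<forall>k::nat. \<forall>\<epsilon>>0. \<exists>T. \<forall>t<T. \<forall>p. \<bar>((dXi C) ^^ k) (ca_curv C) p t\<bar> < \<epsilon>"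
proof -
  interpret F: centro_affine_flow C lam p0
    by unfold_locales (fact smooth periodic star convex flow)+
  obtain M where M: "\<And>p t. \<bar>ca_curv C p t\<bar> \<le> M" using bounded by blast
  interpret E: curvature_evolution "ca_metric C" "ca_curv C" M
    by unfold_locales
      (fact F.smooth_g F.g_pos F.periodic_g F.smooth_phi F.periodic_phi F.dT_g F.dT_phi F.phi_zero M)+
  show ?thesis
    using E.psi_tendsto_zero unfolding E.psi_def F.dXi_eq_arc_deriv by blast
qed

end
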